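(* Each normal isotropic extremal $g(t)$, $t\in\mathbb{R}$, of the sub-Lorentzian (anti)metric $d$ on $\mathrm{GL}^+(2,\mathbb{C})$ with origin $g(0)=e$ is a product of two 1-parameter subgroups: $$g(t)=\exp\left(t\sum_{i=0}^6\alpha_ie_i\right)\exp\left(-t\sum_{i=4}^6\alpha_ie_i\right),$$ where $\alpha_i$, $i=0,\dots,6$, are some arbitrary real constants such that $$\alpha_0=\sqrt{\alpha_1^2+\alpha_2^2+\alpha_3^2}=1$$ (i.e. every such extremal has this form for some such constants, and every choice of real constants satisfying this relation occurs).
   Context: $\mathrm{GL}^+(2,\mathbb{C})$ is the Lie group of complex $2\times2$ matrices with positive real determinant, with unit $e=I$; its Lie algebra $\mathfrak{g}=\mathfrak{gl}^+(2,\mathbb{C})$ (complex $2\times2$ matrices with real trace) has the real basis $e_0=\frac12 I$, $e_1=\frac12\begin{pmatrix}0&1\\1&0\end{pmatrix}$, $e_2=\frac12\begin{pmatrix}0&\mathbf{i}\\-\mathbf{i}&0\end{pmatrix}$, $e_3=\frac12\begin{pmatrix}1&0\\0&-1\end{pmatrix}$, $e_4=\mathbf{i}e_1$, $e_5=\mathbf{i}e_2$, $e_6=\mathbf{i}e_3$. On $\mathfrak{g}$, $\langle\cdot,\cdot\rangle$ is the pseudoscalar product with $\langle u,u\rangle=u_0^2-\sum_{k=1}^6u_k^2$ for $u=\sum u_ke_k$. $H=\mathrm{span}_{\mathbb{R}}(e_0,e_1,e_2,e_3)$ is the space of Hermitian matrices. $l_g:h\mapsto gh$ is the left shift. A horizontal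 curve is a Lipschitzian curve with $g'(t)=dl_{g(t)}(u(t))$, $u(t)\in H$ for almost all $t$; it is nonspacelike if $\langle u(t),u(t)\rangle\ge0$, isotropic if $\langle u(t),u(t)\rangle=0$, $u(t)\neq0$, and future directed if $\langle u(t),e_0\rangle>0$, for almost all $t$. The sub-Lorentzian (anti)metric $d(x,y)$ is the supremum of lengths $\int\sqrt{\langle u,u\rangle}\,dt$ of future directed nonspacelike horizontal curves from $x$ to $y$ ($-\infty$ if there are none). Identify $\mathfrak{g}^*$ with $\mathfrak{g}$ via $\langle\cdot,\cdot\rangle$. Put $W=\{w\in H\mid\langle w,e_0\rangle=0,\ \langle w,w\rangle=-1\}$. A normal isotropic extremal is a future directed isotropic horizontal curve with control normalized as $u(t)=e_0+w(t)$, $w(t)\in W$, for which there is an absolutely continuous $\psi(t)\in\mathfrak{g}^*$ with $\psi(t)(e_0)\equiv1$ such that for almost all $t$: $\frac{d}{dt}\psi(t)(v)=\psi(t)([u(t),v])$ for all $v\in\mathfrak{g}$, and $\langle\psi(t),w(t)\rangle=\min_{w\in W}\langle\psi(t),w\rangle=-1$. *)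

theory Defs
  imports "HOL-Analysis.Analysis"
begin

section \<open>The group, its Lie algebra and the exponential map\<close>

definition GL_plus :: "(complex^2^2) set" where
  "GL_plus = {A. \<exists>r>0. det A = complex_of_real r}"

definition gl_plus :: "(complex^2^2) set" where
  "gl_plus = {A. trace A \<in> \<real>}"

definition lie_bracket :: "complex^2^2 \<Rightarrow> complex^2^2 \<Rightarrow> complex^2^2" where
  "lie_bracket A B = A ** B - B ** A"

text \<open>
  The type \<open>complex^2^2\<close> carries the componentwise multiplication, so the library functions
  \<open>power\<close> and \<open>exp\<close> do not express matrix powers and the matrix exponential.
\<close>

definition mat_exp :: "complex^2^2 \<Rightarrow> complex^2^2" where
  "mat_exp A = (\<Sum>n. (((**) A) ^^ n) (mat 1) /\<^sub>R fact n)"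

definition mat2 :: "complex \<Rightarrow> complex \<Rightarrow> complex \<Rightarrow> complex \<Rightarrow> complex^2^2" where
  "mat2 a b c d = vector [vector [a, b], vector [c, d]]"

text \<open>Only the indices up to 6 are meant.\<close>

definition gl_basis :: "nat \<Rightarrow> complex^2^2" where
  "gl_basis k = (1/2) *\<^sub>R
     (if k = 0 then mat2 1 0 0 1
      else if k = 1 then mat2 0 1 1 0
      else if k = 2 then mat2 0 \<i> (-\<i>) 0
      else if k = 3 then mat2 1 0 0 (-1)
      else if k = 4 then mat2 0 \<i> \<i> 0
      else if k = 5 then mat2 0 (-1) 1 0
      else mat2 \<i> 0 0 (-\<i>))"

definition gl_coord :: "nat \<Rightarrow> complex^2^2 \<Rightarrow> real" where
  "gl_coord k u = representation (gl_basis ` {0..6}) u (gl_basis k)"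

definition lie_form :: "complex^2^2 \<Rightarrow> complex^2^2 \<Rightarrow> real" where
  "lie_form u v = gl_coord 0 u * gl_coord 0 v - (\<Sum>k=1..6. gl_coord k u * gl_coord k v)"

definition horizontal_space :: "(complex^2^2) set" where
  "horizontal_space = span (gl_basis ` {0..3})"


section \<open>Horizontal curves and normal isotropic extremals\<close>

text \<open>
  Curves are parametrized by the whole real line; being Lipschitzian or absolutely continuous
  is then understood on every compact interval. Since the left shift by \<open>g t\<close> is the
  restriction of a linear map, its differential sends \<open>u\<close> to \<open>g t ** u\<close>.
\<close>

definition horizontal_curve :: "(real \<Rightarrow> complex^2^2) \<Rightarrow> (real \<Rightarrow> complex^2^2) \<Rightarrow> bool" where
  "horizontal_curve g u \<longleftrightarrow>
     (\<forall>t. g t \<in> GL_plus) \<and>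
     (\<forall>a b. \<exists>L. L-lipschitz_on {a..b} g) \<and>
     (AE t in lebesgue. u t \<in> horizontal_space \<and>
        (g has_vector_derivative (g t ** u t)) (at t))"

definition isotropic :: "(real \<Rightarrow> complex^2^2) \<Rightarrow> bool" where
  "isotropic u \<longleftrightarrow> (AE t in lebesgue. lie_form (u t) (u t) = 0 \<and> u t \<noteq> 0)"

definition future_directed :: "(real \<Rightarrow> complex^2^2) \<Rightarrow> bool" where
  "future_directed u \<longleftrightarrow> (AE t in lebesgue. lie_form (u t) (gl_basis 0) > 0)"

definition absolutely_continuous_on :: "real set \<Rightarrow> (real \<Rightarrow> 'a::real_normed_vector) \<Rightarrow> bool" where
  "absolutely_continuous_on S f \<longleftrightarrow>
     (\<forall>\<epsilon>>0. \<exists>\<delta>>0. \<forall>I :: (real \<times> real) set.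
        finite I \<and> (\<forall>(a, b)\<in>I. a \<le> b \<and> {a..b} \<subseteq> S) \<and>
        disjoint_family_on (\<lambda>(a, b). {a<..<b}) I \<and> (\<Sum>(a, b)\<in>I. b - a) < \<delta>
        \<longrightarrow> (\<Sum>(a, b)\<in>I. norm (f b - f a)) < \<epsilon>)"

definition unit_directions :: "(complex^2^2) set" where
  "unit_directions = {w \<in> horizontal_space. lie_form w (gl_basis 0) = 0 \<and> lie_form w w = -1}"

text \<open>
  The covector \<open>\<psi> t\<close> is represented by an element of the Lie algebra through \<open>lie_form\<close>:
  its value at \<open>v\<close> is \<open>lie_form (\<psi> t) v\<close>.
\<close>

definition normal_isotropic_extremal :: "(real \<Rightarrow> complex^2^2) \<Rightarrow> bool" where
  "normal_isotropic_extremal g \<longleftrightarrow>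
     (\<exists>u w \<psi>.
        horizontal_curve g u \<and> isotropic u \<and> future_directed u \<and>
        (AE t in lebesgue. w t \<in> unit_directions \<and> u t = gl_basis 0 + w t) \<and>
        (\<forall>t. \<psi> t \<in> gl_plus) \<and>
        (\<forall>a b. absolutely_continuous_on {a..b} \<psi>) \<and>
        (\<forall>t. lie_form (\<psi> t) (gl_basis 0) = 1) \<and>
        (AE t in lebesgue.
           (\<forall>v\<in>gl_plus. ((\<lambda>s. lie_form (\<psi> s) v) has_real_derivative
                            lie_form (\<psi> t) (lie_bracket (u t) v)) (at t)) \<and>
           is_arg_min (lie_form (\<psi> t)) (\<lambda>w'. w' \<in> unit_directions) (w t) \<and>
           lie_form (\<psi> t) (w t) = -1))"


section \<open>Coordinates\<close>

lemma mat2_nth [simp]: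
  "mat2 a b c d $ 1 $ 1 = a" "mat2 a b c d $ 1 $ 2 = b"
  "mat2 a b c d $ 2 $ 1 = c" "mat2 a b c d $ 2 $ 2 = d"
  by (simp_all add: mat2_def)

lemma gl_basis_scaled_i:
  "gl_basis 4 $ i $ j = \<i> * gl_basis 1 $ i $ j"
  "gl_basis 5 $ i $ j = \<i> * gl_basis 2 $ i $ j"
  "gl_basis 6 $ i $ j = \<i> * gl_basis 3 $ i $ j"
  using exhaust_2[of i] exhaust_2[of j] by (auto simp: gl_basis_def)

lemma atLeast0AtMost_6: "{0..6::nat} = {0, 1, 2, 3, 4, 5, 6}"
  by auto

lemma sum_gl_basis:
  "(\<Sum>k=0..6. c k *\<^sub>R gl_basis k) = (1/2) *\<^sub>R
     mat2 (Complex (c 0 + c 3) (c 6)) (Complex (c 1 - c 5) (c 2 + c 4))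
          (Complex (c 1 + c 5) (c 4 - c 2)) (Complex (c 0 - c 3) (- c 6))"
  by (simp add: atLeast0AtMost_6 gl_basis_def vec_eq_iff forall_2 complex_eq_iff)

lemma sum_gl_basis_eq_iff:
  "(\<Sum>k=0..6. c k *\<^sub>R gl_basis k) = (\<Sum>k=0..6. d k *\<^sub>R gl_basis k) \<longleftrightarrow> (\<forall>k\<in>{0..6}. c k = d k)"
  unfolding sum_gl_basis
  by (auto simp: atLeast0AtMost_6 vec_eq_iff forall_2)

lemma inj_on_gl_basis: "inj_on gl_basis {0..6}"
  by (auto simp: inj_on_def atLeast0AtMost_6 gl_basis_def vec_eq_iff forall_2 complex_eq_iff)

lemma independent_gl_basis: "independent (gl_basis ` {0..6})"
proof (rule independent_if_scalars_zero)
  fix f x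
  assume 0: "(\<Sum>x\<in>gl_basis ` {0..6}. f x *\<^sub>R x) = 0" and "x \<in> gl_basis ` {0..6}"
  then obtain k where k: "k \<in> {0..6}" "x = gl_basis k" by blast
  have "(\<Sum>k=0..6. f (gl_basis k) *\<^sub>R gl_basis k) = (\<Sum>k=0..6. 0 *\<^sub>R gl_basis k)"
    using 0 by (simp add: sum.reindex[OF inj_on_gl_basis])
  then show "f x = 0"
    using k by (simp only: sum_gl_basis_eq_iff)
qed simp

lemma gl_coord_sum:
  assumes "k \<in> {0..6}"
  shows "gl_coord k (\<Sum>j=0..6. c j *\<^sub>R gl_basis j) = c k"
proof -
  have "gl_coord k (\<Sum>j=0..6. c j *\<^sub>R gl_basis j) =
        (\<Sum>j=0..6. c j * (if gl_basis j = gl_basis k then 1 else 0))"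
  proof -
    have "representation (gl_basis ` {0..6}) (\<Sum>j=0..6. c j *\<^sub>R gl_basis j) (gl_basis k) =
          (\<Sum>j=0..6. representation (gl_basis ` {0..6}) (c j *\<^sub>R gl_basis j) (gl_basis k))"
      by (subst representation_sum[OF independent_gl_basis])
        (simp_all only: span_scale span_base imageI)
    also have "\<dots> = (\<Sum>j=0..6. c j * (if gl_basis j = gl_basis k then 1 else 0))"
    proof (rule sum.cong)
      fix j :: nat
      assume j: "j \<in> {0..6}"
      then have "gl_basis j \<in> gl_basis ` {0..6}" by blast
      then show "representation (gl_basis ` {0..6}) (c j *\<^sub>R gl_basis j) (gl_basis k) =
                 c j * (if gl_basis j = gl_basis k then 1 else 0)"
        by (auto simp: representation_scale[OF independent_gl_basis span_base]
              representation_basis[OF independent_gl_basis])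
    qed simp
    finally show ?thesis
      by (simp add: gl_coord_def)
  qed
  also have "\<dots> = (\<Sum>j=0..6. if j = k then c j else 0)"
    using assms inj_on_gl_basis by (intro sum.cong) (auto simp: inj_on_def)
  finally show ?thesis
    using assms by simp
qed

lemma gl_plus_expand:
  assumes "A \<in> gl_plus"
  obtains c where "A = (\<Sum>k=0..6. c k *\<^sub>R gl_basis k)"
proof -
  have tr: "Im (A$2$2) = - Im (A$1$1)"
    using assms by (auto simp: gl_plus_def trace_def sum_2 complex_is_Real_iff add_eq_0_iff)
  define c :: "nat \<Rightarrow> real" where "c k =
    (if k = 0 then Re (A$1$1 + A$2$2) else if k = 1 then Re (A$1$2 + A$2$1)
     else if k = 2 then Im (A$1$2 - A$2$1) else if k = 3 then Re (A$1$1 - A$2$2)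
     else if k = 4 then Im (A$1$2 + A$2$1) else if k = 5 then Re (A$2$1 - A$1$2)
     else Im (A$1$1 - A$2$2))" for k
  have "A = (\<Sum>k=0..6. c k *\<^sub>R gl_basis k)"
    unfolding sum_gl_basis by (simp add: vec_eq_iff forall_2 complex_eq_iff c_def tr)
  then show ?thesis using that by blast
qed

lemma gl_plus_eq_span: "gl_plus = span (gl_basis ` {0..6})"
proof
  show "gl_plus \<subseteq> span (gl_basis ` {0..6})"
  proof
    fix A
    assume "A \<in> gl_plus"
    then obtain c where "A = (\<Sum>k=0..6. c k *\<^sub>R gl_basis k)"
      by (rule gl_plus_expand)
    moreover have "(\<Sum>k=0..6. c k *\<^sub>R gl_basis k) \<in> span (gl_basis ` {0..6})"
      by (intro span_sum span_scale span_base imageI)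
    ultimately show "A \<in> span (gl_basis ` {0..6})" by simp
  qed
  have "subspace gl_plus"
    by (auto simp: subspace_def gl_plus_def trace_def sum_2 complex_is_Real_iff algebra_simps
             simp flip: distrib_left)
  moreover have "gl_basis ` {0..6} \<subseteq> gl_plus"
    by (auto simp: gl_plus_def trace_def sum_2 complex_is_Real_iff gl_basis_def)
  ultimately show "span (gl_basis ` {0..6}) \<subseteq> gl_plus"
    by (rule span_minimal[rotated])
qed

lemma horizontal_space_hermitian:
  "horizontal_space = {A. \<forall>i j. A $ i $ j = cnj (A $ j $ i)}" (is "_ = ?H")
proof
  have "subspace ?H"
  proof (rule subspaceI)
    fix A B
    assume "A \<in> ?H" "B \<in> ?H"
    then have A: "A $ i $ j = cnj (A $ j $ i)" and B: "B $ i $ j = cnj (B $ j $ i)" for i j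
      by blast+
    have "(A + B) $ i $ j = cnj ((A + B) $ j $ i)" for i j
      unfolding vector_add_component by (subst A, subst B) simp
    then show "A + B \<in> ?H" by blast
  next
    fix c A
    assume "A \<in> ?H"
    then have A: "A $ i $ j = cnj (A $ j $ i)" for i j
      by blast
    have "(c *\<^sub>R A) $ i $ j = cnj ((c *\<^sub>R A) $ j $ i)" for i j
      unfolding vector_scaleR_component by (subst A) simp
    then show "c *\<^sub>R A \<in> ?H" by blast
  qed simp
  moreover have "gl_basis ` {0..3} \<subseteq> ?H"
  proof -
    have "{0..3::nat} = {0, 1, 2, 3}" by auto
    then show ?thesis
      by (simp add: gl_basis_def forall_2)
  qed
  ultimately show "horizontal_space \<subseteq> ?H"
    unfolding horizontal_space_def by (rule span_minimal[rotated])
  show "?H \<subseteq> horizontal_space"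
  proof
    fix A
    assume "A \<in> ?H"
    then have sym: "A $ i $ j = cnj (A $ j $ i)" for i j
      by blast
    have "Im (A$1$1) = 0" "Im (A$2$2) = 0"
      using arg_cong[OF sym[of 1 1], of Im] arg_cong[OF sym[of 2 2], of Im] by simp_all
    moreover have "Re (A$2$1) = Re (A$1$2)" "Im (A$2$1) = - Im (A$1$2)"
      using arg_cong[OF sym[of 2 1], of Re] arg_cong[OF sym[of 2 1], of Im] by simp_all
    ultimately
    have "A = Re (A$1$1 + A$2$2) *\<^sub>R gl_basis 0 + (2 * Re (A$1$2)) *\<^sub>R gl_basis 1 +
                   (2 * Im (A$1$2)) *\<^sub>R gl_basis 2 + Re (A$1$1 - A$2$2) *\<^sub>R gl_basis 3"
      by (simp add: vec_eq_iff forall_2 complex_eq_iff gl_basis_def add_divide_distrib diff_divide_distrib)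
    also have "\<dots> \<in> horizontal_space"
      unfolding horizontal_space_def
      by (intro span_add span_scale span_base imageI) auto
    finally show "A \<in> horizontal_space" .
  qed
qed

end

theory Submission
  imports Defs
begin

text \<open>
  On \<open>gl_plus\<close> the pseudoscalar product is \<open>2 tr X tr Y - 2 (X \<bullet> Y)\<close>, where \<open>\<bullet>\<close> is the real part
  of the Hermitian product of matrices (\<open>lie_form_eq\<close>). In this form the adjoint of \<open>v \<mapsto> [u, v]\<close>
  for Hermitian \<open>u\<close> is read off at once, and the costate equation becomes the matrix equation
  \<open>\<psi>' = [u, \<psi>]\<close> (\<open>costate_vector_derivative\<close>). Split \<open>\<psi> = P + K\<close> into its Hermitian and
  skew-Hermitian parts. On the unit sphere of directions the covector \<open>\<psi>\<close> acts through \<open>P - e\<^sub>0\<close>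
  alone, so the minimum \<open>-1\<close> forces \<open>w\<close> to be the vector \<open>P - e\<^sub>0\<close> by the equality case of
  Cauchy-Schwarz (\<open>arg_min_unit_directionsD\<close>). Thus the control is \<open>u = P\<close> for almost every time.

  Both \<open>g' = g P\<close> and \<open>\<psi>' = [P, \<psi>]\<close> now have continuous right-hand sides, so the absolutely
  continuous curves \<open>g\<close> and \<open>\<psi>\<close> satisfy them at every time (\<open>absolutely_continuous_on_imp_C1\<close>).
  Since \<open>[P, P + K] = [P, K]\<close> is Hermitian, \<open>K\<close> is constant, and with \<open>B = -K\<close> the Hermitian part
  obeys \<open>P' = [B, P]\<close>. Hence \<open>P\<close> is rotated rigidly, \<open>P t = exp (tB) P\<^sub>0 exp (-tB)\<close>. In the rotating
  frame \<open>g exp (tB)\<close> the equation for \<open>g\<close> has the constant coefficient \<open>P\<^sub>0 + B\<close>, which gives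
  \<open>g t = exp (t (P\<^sub>0 + B)) exp (-tB)\<close> (\<open>left_shift_ode_solution\<close>). The coordinates of \<open>P\<^sub>0 + B\<close> are
  the constants \<open>\<alpha>\<^sub>i\<close>: those of \<open>P\<^sub>0\<close>, the initial control, have indices 0 to 3 and carry the normalization,
  those of \<open>B\<close> have indices 4 to 6 and are free.

  Conversely, every such product has control \<open>u = exp (tB) P\<^sub>0 exp (-tB)\<close>. As \<open>exp (tB)\<close> is unitary,
  \<open>u - e\<^sub>0\<close> stays a unit Hermitian direction, and \<open>\<psi> = u - B\<close> is a covector with all the required
  properties.
\<close>

section \<open>Absolutely continuous curves\<close>

lemma absolutely_continuous_on_lipschitz:
  fixes f :: "real \<Rightarrow> 'a::real_normed_vector"
  assumes L: "L-lipschitz_on S f"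
  shows "absolutely_continuous_on S f"
  unfolding absolutely_continuous_on_def
proof (intro allI impI)
  fix e :: real assume e: "e > 0"
  have L0: "L \<ge> 0" using L by (rule lipschitz_on_nonneg)
  define d where "d = e / (L + 1)"
  have d: "d > 0" using e L0 by (simp add: d_def)
  have "(\<Sum>(a, b)\<in>I. norm (f b - f a)) < e"
    if I: "finite I" "\<forall>(a, b)\<in>I. a \<le> b \<and> {a..b} \<subseteq> S" "(\<Sum>(a, b)\<in>I. b - a) < d" for I
  proof -
    have "(\<Sum>(a, b)\<in>I. norm (f b - f a)) \<le> (\<Sum>(a, b)\<in>I. L * (b - a))"
    proof (rule sum_mono, clarify)
      fix a b assume "(a, b) \<in> I"
      then have "a \<le> b" "a \<in> S" "b \<in> S" using I(2) by force+
      then show "norm (f b - f a) \<le> L * (b - a)"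
        using lipschitz_onD[OF L, of b a] by (simp add: dist_norm)
    qed
    also have "\<dots> = L * (\<Sum>(a, b)\<in>I. b - a)"
      by (simp add: sum_distrib_left case_prod_unfold)
    also have "\<dots> \<le> L * d" using I(3) L0 by (intro mult_left_mono) auto
    also have "\<dots> < (L + 1) * d" using d by simp
    also have "\<dots> = e" using L0 by (simp add: d_def)
    finally show ?thesis .
  qed
  with d show "\<exists>\<delta>>0. \<forall>I. finite I \<and> (\<forall>(a, b)\<in>I. a \<le> b \<and> {a..b} \<subseteq> S) \<and>
        disjoint_family_on (\<lambda>(a, b). {a<..<b}) I \<and> (\<Sum>(a, b)\<in>I. b - a) < \<delta>
        \<longrightarrow> (\<Sum>(a, b)\<in>I. norm (f b - f a)) < e"
    by blast
qed

lemma absolutely_continuous_on_diff: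
  fixes f g :: "real \<Rightarrow> 'a::real_normed_vector"
  assumes f: "absolutely_continuous_on S f" and g: "absolutely_continuous_on S g"
  shows "absolutely_continuous_on S (\<lambda>t. f t - g t)"
  unfolding absolutely_continuous_on_def
proof (intro allI impI)
  fix e :: real assume e: "e > 0"
  let ?P = "\<lambda>I d. finite I \<and> (\<forall>(a, b)\<in>I. a \<le> b \<and> {a..b} \<subseteq> S) \<and>
        disjoint_family_on (\<lambda>(a, b). {a<..<b}) I \<and> (\<Sum>(a, b)\<in>I. b - a) < d"
  obtain d1 where d1: "d1 > 0" "\<And>I. ?P I d1 \<Longrightarrow> (\<Sum>(a, b)\<in>I. norm (f b - f a)) < e/2"
    using f[unfolded absolutely_continuous_on_def, rule_format, of "e/2"] e by auto
  obtain d2 where d2: "d2 > 0" "\<And>I. ?P I d2 \<Longrightarrow> (\<Sum>(a, b)\<in>I. norm (g b - g a)) < e/2"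
    using g[unfolded absolutely_continuous_on_def, rule_format, of "e/2"] e by auto
  have "(\<Sum>(a, b)\<in>I. norm ((f b - g b) - (f a - g a))) < e" if "?P I (min d1 d2)" for I
  proof -
    have "(\<Sum>(a, b)\<in>I. norm ((f b - g b) - (f a - g a))) \<le>
        (\<Sum>(a, b)\<in>I. norm (f b - f a) + norm (g b - g a))"
    proof (rule sum_mono, clarify)
      fix a b
      show "norm ((f b - g b) - (f a - g a)) \<le> norm (f b - f a) + norm (g b - g a)"
        using norm_triangle_ineq4[of "f b - f a" "g b - g a"] by (simp add: algebra_simps)
    qed
    also have "\<dots> = (\<Sum>(a, b)\<in>I. norm (f b - f a)) + (\<Sum>(a, b)\<in>I. norm (g b - g a))"
      by (simp add: case_prod_unfold sum.distrib)
    also have "\<dots> < e"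
      using d1(2)[of I] d2(2)[of I] that by linarith
    finally show ?thesis .
  qed
  moreover have "min d1 d2 > 0" using d1(1) d2(1) by simp
  ultimately show "\<exists>\<delta>>0. \<forall>I. ?P I \<delta> \<longrightarrow> (\<Sum>(a, b)\<in>I. norm ((f b - g b) - (f a - g a))) < e"
    by blast
qed

lemma absolutely_continuous_on_imp_continuous_on:
  fixes f :: "real \<Rightarrow> 'a::real_normed_vector"
  assumes f: "absolutely_continuous_on {a..b} f"
  shows "continuous_on {a..b} f"
  unfolding continuous_on_iff
proof (intro ballI allI impI)
  fix x e :: real assume x: "x \<in> {a..b}" and e: "e > 0"
  obtain d where d: "d > 0" and *: "\<And>I. finite I \<and> (\<forall>(s, t)\<in>I. s \<le> t \<and> {s..t} \<subseteq> {a..b}) \<and>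
        disjoint_family_on (\<lambda>(s, t). {s<..<t}) I \<and> (\<Sum>(s, t)\<in>I. t - s) < d
        \<Longrightarrow> (\<Sum>(s, t)\<in>I. norm (f t - f s)) < e"
    using f[unfolded absolutely_continuous_on_def, rule_format, OF e] by auto
  have "dist (f y) (f x) < e" if y: "y \<in> {a..b}" "dist y x < d" for y
  proof (cases "x \<le> y")
    case True
    then show ?thesis
      using *[of "{(x, y)}"] y x by (simp add: disjoint_family_on_def dist_norm)
  next
    case False
    then show ?thesis
      using *[of "{(y, x)}"] y x by (simp add: disjoint_family_on_def dist_norm norm_minus_commute)
  qed
  with d show "\<exists>d>0. \<forall>y\<in>{a..b}. dist y x < d \<longrightarrow> dist (f y) (f x) < e" by blast
qed

text \<open>
  A covering argument replaces the Lebesgue theory of absolutely continuous functions. Outside a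
  null set \<open>N\<close> the increments of \<open>f\<close> over short intervals around a point are small compared with
  their lengths; \<open>N\<close> itself is covered by an open set of small measure. A tagged division of
  \<open>{a..b}\<close> that is fine for the resulting gauge splits into intervals with tags outside \<open>N\<close>, whose
  increments add up to little because the lengths add up to \<open>b - a\<close>, and intervals with tags in \<open>N\<close>,
  whose total length is so small that absolute continuity bounds their increments.
\<close>

lemma absolutely_continuous_on_zero_derivative:
  fixes f :: "real \<Rightarrow> 'a::real_normed_vector"
  assumes ab: "a \<le> b" and ac: "absolutely_continuous_on {a..b} f"
    and der: "AE t in lebesgue. t \<in> {a..b} \<longrightarrow> (f has_vector_derivative 0) (at t within {a..b})"
  shows "f b = f a"
proof -
  obtain N where N: "N \<in> null_sets lebesgue"
    and derN: "\<And>t. t \<notin> N \<Longrightarrow> t \<in> {a..b} \<Longrightarrow> (f has_vector_derivative 0) (at t within {a..b})"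
    using der unfolding eventually_ae_filter by auto
  have "norm (f b - f a) \<le> e" if e: "e > 0" for e
  proof -
    define e1 where "e1 = e / 2 / (b - a + 1)"
    have nz: "b - a + 1 \<noteq> 0" using ab by simp
    have e1: "e1 > 0" using e ab by (simp add: e1_def)
    obtain d where d: "d > 0" and acd: "\<And>I. finite I \<Longrightarrow> (\<forall>(s, t)\<in>I. s \<le> t \<and> {s..t} \<subseteq> {a..b}) \<Longrightarrow>
        disjoint_family_on (\<lambda>(s, t). {s<..<t}) I \<Longrightarrow> (\<Sum>(s, t)\<in>I. t - s) < d
        \<Longrightarrow> (\<Sum>(s, t)\<in>I. norm (f t - f s)) < e/2"
      using ac[unfolded absolutely_continuous_on_def, rule_format, of "e/2"] e by auto
    have "N \<in> sets lebesgue" using N by auto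
    then obtain U where U: "open U" "N \<subseteq> U" "U - N \<in> lmeasurable" "emeasure lebesgue (U - N) < ennreal d"
      using sets_lebesgue_outer_open[of N d] d by blast
    have "emeasure lebesgue U = emeasure lebesgue (U - N)"
      using N U by (simp add: emeasure_Diff_null_set)
    then have Ud: "emeasure lebesgue U < ennreal d" using U(4) by simp
    have Um: "U \<in> lmeasurable" using Ud U(1)
      by (intro fmeasurableI) (auto intro: order.strict_trans)
    have mU: "measure lebesgue U < d"
      using Ud d by (simp add: emeasure_eq_measure2[OF Um] ennreal_less_iff)
    have "\<exists>r>0. (x \<in> N \<longrightarrow> ball x r \<subseteq> U) \<and> (x \<notin> N \<longrightarrow> x \<in> {a..b} \<longrightarrow>
        (\<forall>y\<in>{a..b} \<inter> ball x r. norm (f y - f x) \<le> e1 * \<bar>y - x\<bar>))" for x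
    proof (cases "x \<in> N")
      case True
      then show ?thesis using U(1,2) by (meson openE subsetD)
    next
      case nN: False
      show ?thesis
      proof (cases "x \<in> {a..b}")
        case True
        then have "(f has_vector_derivative 0) (at x within {a..b})" using derN nN by blast
        then have "(f has_derivative (\<lambda>h. 0)) (at x within {a..b})"
          by (simp add: has_vector_derivative_def)
        then obtain r where "r > 0" "\<And>y. y \<in> {a..b} \<Longrightarrow> norm (y - x) < r \<Longrightarrow>
            norm (f y - f x) \<le> e1 * norm (y - x)"
          unfolding has_derivative_within_alt using e1 by auto
        then show ?thesis using nN
          by (intro exI[of _ r]) (auto simp: dist_real_def abs_minus_commute)
      next
        case False
        then show ?thesis using nN by (intro exI[of _ 1]) auto
      qed
    qed
    then obtain r where r: "\<And>x. r x > 0" "\<And>x. x \<in> N \<Longrightarrow> ball x (r x) \<subseteq> U"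
      "\<And>x y. x \<notin> N \<Longrightarrow> x \<in> {a..b} \<Longrightarrow> y \<in> {a..b} \<Longrightarrow> y \<in> ball x (r x) \<Longrightarrow> norm (f y - f x) \<le> e1 * \<bar>y - x\<bar>"
      by (metis IntI)
    have "gauge (\<lambda>x. ball x (r x))" using r(1) by (simp add: gauge_def)
    then obtain p where p: "p tagged_division_of {a..b}" and fine: "(\<lambda>x. ball x (r x)) fine p"
      by (rule fine_division_exists_real)
    note tp = tagged_division_ofD[OF p]
    have fin: "finite p" by (rule tp(1))
    have K: "\<exists>s t. K = {s..t} \<and> s \<le> x \<and> x \<le> t \<and> {s..t} \<subseteq> {a..b} \<and> {s..t} \<subseteq> ball x (r x)
        \<and> Inf K = s \<and> Sup K = t"
      if xK: "(x, K) \<in> p" for x K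
    proof -
      obtain s t where "K = {s..t}" using tp(4)[OF xK] by auto
      with tp(2,3)[OF xK] fineD[OF fine xK] show ?thesis by force
    qed
    \<comment> \<open>Intervals of length zero are kept apart: the passage from tagged intervals to endpoints is injective on the others.\<close>
    let ?D = "\<lambda>(x, K). norm (f (Sup K) - f (Inf K))"
    let ?G = "{(x, K) \<in> p. x \<notin> N}" and ?B = "{(x, K) \<in> p. x \<in> N \<and> Inf K < Sup K}"
      and ?Z = "{(x, K) \<in> p. x \<in> N \<and> \<not> Inf K < Sup K}"
    have G: "sum ?D ?G \<le> e/2"
    proof -
      have "sum ?D ?G \<le> (\<Sum>(x, K)\<in>?G. e1 * (Sup K - Inf K))"
      proof (rule sum_mono, clarify)
        fix x K assume xK: "(x, K) \<in> p" "x \<notin> N"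
        then obtain s t where st: "K = {s..t}" "s \<le> x" "x \<le> t" "{s..t} \<subseteq> {a..b}" "{s..t} \<subseteq> ball x (r x)"
          "Inf K = s" "Sup K = t" using K by blast
        have "x \<in> {a..b}" "s \<in> {a..b}" "t \<in> {a..b}" "s \<in> ball x (r x)" "t \<in> ball x (r x)"
          using st(2-5) by (auto simp: subset_eq)
        then have "norm (f t - f x) \<le> e1 * \<bar>t - x\<bar>" "norm (f s - f x) \<le> e1 * \<bar>s - x\<bar>"
          using r(3) xK(2) by blast+
        then have "norm (f t - f s) \<le> e1 * \<bar>t - x\<bar> + e1 * \<bar>s - x\<bar>"
          using norm_triangle_ineq4[of "f t - f x" "f s - f x"] by simp
        also have "\<dots> = e1 * (Sup K - Inf K)" using st by (simp add: algebra_simps)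
        finally show "norm (f (Sup K) - f (Inf K)) \<le> e1 * (Sup K - Inf K)" using st by simp
      qed
      also have "\<dots> \<le> (\<Sum>(x, K)\<in>p. e1 * (Sup K - Inf K))"
      proof (rule sum_mono2[OF fin])
        fix i assume "i \<in> p - ?G"
        then have "(fst i, snd i) \<in> p" by simp
        from K[OF this] show "0 \<le> (case i of (x, K) \<Rightarrow> e1 * (Sup K - Inf K))"
          using e1 by (auto simp: case_prod_unfold)
      qed auto
      also have "\<dots> = e1 * (b - a)"
        using additive_tagged_division_1[OF ab p, of "\<lambda>x. x"]
        by (simp add: case_prod_unfold flip: sum_distrib_left)
      also have "\<dots> \<le> e1 * (b - a + 1)" using e1 by simp
      also have "\<dots> = e/2" using e1_def by (simp only: nonzero_eq_divide_eq[OF nz])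
      finally show ?thesis .
    qed
    have Z: "sum ?D ?Z = 0"
    proof (rule sum.neutral, clarify)
      fix x K assume "(x, K) \<in> p" "\<not> Inf K < Sup K"
      then have "Sup K = Inf K" using K[of x K] by force
      then show "norm (f (Sup K) - f (Inf K)) = 0" by simp
    qed
    have B: "sum ?D ?B \<le> e/2"
    proof -
      let ?h = "\<lambda>(x::real, K::real set). (Inf K, Sup K)"
      have finB: "finite ?B" using fin by (rule rev_finite_subset) auto
      have disj: "{Inf K<..<Sup K} \<inter> {Inf K'<..<Sup K'} = {}"
        if "(x, K) \<in> p" "(x', K') \<in> p" "(x, K) \<noteq> (x', K')" for x x' K K'
        using tp(5)[OF that] K[OF that(1)] K[OF that(2)] by fastforce
      have inj: "inj_on ?h ?B"
      proof (rule inj_onI, clarsimp)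
        fix x K x' K'
        assume a: "(x, K) \<in> p" "(x', K') \<in> p" "Inf K = Inf K'" "Sup K = Sup K'" "Inf K' < Sup K'"
        then have "{Inf K<..<Sup K} \<inter> {Inf K'<..<Sup K'} \<noteq> {}" by simp
        then show "x = x' \<and> K = K'" using disj[OF a(1,2)] by blast
      qed
      have dj: "disjoint_family_on (\<lambda>(s, t). {s<..<t}) (?h ` ?B)"
      proof (unfold disjoint_family_on_def, intro ballI impI)
        fix i j assume ij: "i \<in> ?h ` ?B" "j \<in> ?h ` ?B" "i \<noteq> j"
        obtain x K where i: "(x, K) \<in> p" "i = (Inf K, Sup K)" using ij(1) by auto
        obtain x' K' where j: "(x', K') \<in> p" "j = (Inf K', Sup K')" using ij(2) by auto
        have "(x, K) \<noteq> (x', K')" using i(2) j(2) ij(3) by auto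
        from disj[OF i(1) j(1) this]
        show "(\<lambda>(s, t). {s<..<t}) i \<inter> (\<lambda>(s, t). {s<..<t}) j = {}"
          unfolding i(2) j(2) by simp
      qed
      have "(\<Sum>(s, t)\<in>?h ` ?B. t - s) = (\<Sum>i\<in>?h ` ?B. measure lebesgue ((\<lambda>(s, t). {s<..<t}) i))"
        by (rule sum.cong) auto
      also have "\<dots> = measure lebesgue (\<Union>i\<in>?h ` ?B. (\<lambda>(s, t). {s<..<t}) i)"
        using finB dj by (intro measure_finite_Union[symmetric]) auto
      also have "\<dots> \<le> measure lebesgue U"
      proof (rule measure_mono_fmeasurable[OF _ _ Um])
        show "(\<Union>i\<in>?h ` ?B. (\<lambda>(s, t). {s<..<t}) i) \<subseteq> U"
        proof clarsimp
          fix x K y assume xK: "(x, K) \<in> p" "x \<in> N" and y: "Inf K < y" "y < Sup K"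
          then have "y \<in> ball x (r x)" using K[OF xK(1)] by force
          then show "y \<in> U" using r(2)[OF xK(2)] by blast
        qed
        show "(\<Union>i\<in>?h ` ?B. (\<lambda>(s, t). {s<..<t}) i) \<in> sets lebesgue"
          using finB by (intro sets.finite_UN) auto
      qed
      finally have "(\<Sum>(s, t)\<in>?h ` ?B. t - s) < d" using mU by simp
      moreover have "\<forall>(s, t)\<in>?h ` ?B. s \<le> t \<and> {s..t} \<subseteq> {a..b}"
      proof clarify
        fix x K assume "(x, K) \<in> p"
        then show "Inf K \<le> Sup K \<and> {Inf K..Sup K} \<subseteq> {a..b}" using K by force
      qed
      ultimately have "(\<Sum>(s, t)\<in>?h ` ?B. norm (f t - f s)) < e/2"
        using acd[OF finite_imageI[OF finB]] dj by blast
      moreover have "(\<Sum>(s, t)\<in>?h ` ?B. norm (f t - f s)) = sum ?D ?B"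
        by (subst sum.reindex[OF inj]) (simp add: case_prod_unfold)
      ultimately show ?thesis by simp
    qed
    have "norm (f b - f a) = norm (\<Sum>(x, K)\<in>p. f (Sup K) - f (Inf K))"
      using additive_tagged_division_1[OF ab p, of f] by simp
    also have "\<dots> \<le> sum ?D p" by (rule order.trans[OF norm_sum]) (simp add: case_prod_unfold)
    also have "p = ?G \<union> (?B \<union> ?Z)" by auto
    also have "sum ?D \<dots> = sum ?D ?G + (sum ?D ?B + sum ?D ?Z)"
      using fin by (subst sum.union_disjoint, (auto intro: rev_finite_subset)[3],
        subst sum.union_disjoint) (auto intro: rev_finite_subset)
    also have "\<dots> \<le> e" using G B Z by simp
    finally show ?thesis .
  qed
  then have "norm (f b - f a) \<le> 0" by (rule field_le_epsilon) simp
  then show ?thesis by simp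
qed

lemma C1_imp_lipschitz_on:
  fixes f :: "real \<Rightarrow> 'a::real_normed_vector"
  assumes der: "\<And>t. t \<in> {a..b} \<Longrightarrow> (f has_vector_derivative F t) (at t within {a..b})"
    and cont: "continuous_on {a..b} F"
  shows "\<exists>L. L-lipschitz_on {a..b} f"
proof -
  have "bounded (F ` {a..b})" using cont by (intro compact_imp_bounded compact_continuous_image) auto
  then obtain C where C: "C > 0" "\<And>t. t \<in> {a..b} \<Longrightarrow> norm (F t) \<le> C"
    unfolding bounded_pos by blast
  have "C-lipschitz_on {a..b} f"
  proof (rule bounded_derivative_imp_lipschitz)
    show "(f has_derivative (\<lambda>h. h *\<^sub>R F t)) (at t within {a..b})" if "t \<in> {a..b}" for t
      using der[OF that] by (simp add: has_vector_derivative_def)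
    show "onorm (\<lambda>h. h *\<^sub>R F t) \<le> C" if "t \<in> {a..b}" for t
    proof (rule onorm_bound)
      show "norm (h *\<^sub>R F t) \<le> C * norm h" for h
        using mult_right_mono[OF C(2)[OF that], of "norm h"] by (simp add: mult.commute)
    qed (use C in auto)
  qed (use C in auto)
  then show ?thesis by blast
qed

text \<open>
  Subtracting the integral of \<open>F\<close> leaves an absolutely continuous function whose derivative vanishes
  almost everywhere. So a differential equation that holds almost everywhere and has a continuous
  right-hand side holds everywhere, and classical uniqueness arguments apply.
\<close>

lemma absolutely_continuous_on_imp_C1:
  fixes f :: "real \<Rightarrow> 'a::banach"
  assumes ac: "\<And>a b. absolutely_continuous_on {a..b} f"
    and der: "AE t in lebesgue. (f has_vector_derivative F t) (at t)"
    and cont: "continuous_on UNIV F"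
  shows "(f has_vector_derivative F t) (at t)"
proof -
  define G where "G s = integral {t - 1..s} F" for s
  have cont': "continuous_on {a..b} F" for a b
    using cont by (rule continuous_on_subset) simp
  have G: "(G has_vector_derivative F s) (at s within {t - 1..b})" if "s \<in> {t - 1..b}" for s b
    unfolding G_def by (rule integral_has_vector_derivative[OF cont' that])
  have eq: "f s = (f (t - 1) - G (t - 1)) + G s" if s: "s \<in> {t - 1<..<t + 1}" for s
  proof -
    have "\<exists>L. L-lipschitz_on {t - 1..s} G"
      by (rule C1_imp_lipschitz_on[OF G cont'])
    then have "absolutely_continuous_on {t - 1..s} (\<lambda>s. f s - G s)"
      using ac absolutely_continuous_on_diff absolutely_continuous_on_lipschitz by blast
    moreover have "AE x in lebesgue. x \<in> {t - 1..s} \<longrightarrow>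
        ((\<lambda>s. f s - G s) has_vector_derivative 0) (at x within {t - 1..s})"
      using der
    proof eventually_elim
      case (elim x)
      show ?case
        using has_vector_derivative_diff[OF has_vector_derivative_at_within[OF elim] G] by fastforce
    qed
    ultimately have "f s - G s = f (t - 1) - G (t - 1)"
      using s by (intro absolutely_continuous_on_zero_derivative) auto
    then show ?thesis by (simp add: algebra_simps)
  qed
  have "(G has_vector_derivative F t) (at t)"
    using G[of t "t + 1"] by (simp add: at_within_Icc_at)
  then have "((\<lambda>s. (f (t - 1) - G (t - 1)) + G s) has_vector_derivative F t) (at t)"
    by (auto intro!: derivative_eq_intros)
  then show ?thesis
    by (rule has_vector_derivative_transform_within_open[of _ _ _ "{t - 1<..<t + 1}"])
      (use eq in auto)
qed

lemma AE_lebesgue_witness: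
  assumes "AE t in (lebesgue :: real measure). P t"
  shows "\<exists>t. P t"
proof -
  have "ae_filter (lebesgue :: real measure) \<noteq> bot"
    by (simp add: ae_filter_eq_bot_iff)
  then show ?thesis using assms eventually_happens' by blast
qed

section \<open>Matrix products and the matrix exponential\<close>

lemma bounded_bilinear_matrix_mult:
  "bounded_bilinear ((**) :: complex^'n::finite^'m::finite \<Rightarrow> complex^'p::finite^'n \<Rightarrow> complex^'p^'m)"
  unfolding bilinear_conv_bounded_bilinear[symmetric] bilinear_def linear_iff
  by (simp add: matrix_matrix_mult_def vec_eq_iff algebra_simps sum.distrib scaleR_sum_right)

interpretation matrix_mult: bounded_bilinear
  "(**) :: complex^'n::finite^'m::finite \<Rightarrow> complex^'p::finite^'n \<Rightarrow> complex^'p^'m"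
  by (rule bounded_bilinear_matrix_mult)

lemma bounded_linear_matrix_entry: "bounded_linear (\<lambda>A :: complex^2^2. A $ i $ j)"
  by (intro bounded_linear_compose[OF bounded_linear_vec_nth bounded_linear_vec_nth])

text \<open>
  This reduces the differentiation of the matrix exponential to that of complex power series.
\<close>

lemma has_vector_derivative_entrywise:
  fixes X :: "real \<Rightarrow> complex^2^2"
  assumes "\<And>i j. ((\<lambda>t. X t $ i $ j) has_vector_derivative D $ i $ j) (at t)"
  shows "(X has_vector_derivative D) (at t)"
  unfolding has_vector_derivative_def has_derivative_componentwise_within[of X]
proof
  fix b :: "complex^2^2" assume "b \<in> Basis"
  then obtain i j c where b: "b = axis i (axis j c)"
    by (auto simp: Basis_vec_def)
  show "((\<lambda>t. X t \<bullet> b) has_derivative (\<lambda>h. (h *\<^sub>R D) \<bullet> b)) (at t)"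
    using bounded_linear.has_derivative[OF bounded_linear_inner_left
        assms[of i j, unfolded has_vector_derivative_def], of c]
    by (simp add: b inner_axis)
qed

text \<open>
  The iterates multiply by \<open>A\<close> on the left. Moving a factor to the right is needed where \<open>A\<close> has to
  commute with its exponential and where the conjugate transpose reverses the order of factors.
\<close>

lemma mat_pow_commute: "(((**) A) ^^ n) (mat 1) ** A = A ** (((**) A) ^^ n) (mat 1)"
  for A :: "complex^2^2"
  by (induction n) (simp_all add: matrix_mul_assoc[symmetric])

lemma mat_pow_scale:
  "(((**) (t *\<^sub>R A)) ^^ n) (mat 1) = t ^ n *\<^sub>R (((**) A) ^^ n) (mat 1)"
  for A :: "complex^2^2"
  by (induction n) (simp_all add: matrix_mult.scaleR_left matrix_mult.scaleR_right mult.commute)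

lemma summable_mat_exp:
  fixes A :: "complex^2^2"
  shows "summable (\<lambda>n. norm ((((**) A) ^^ n) (mat 1) /\<^sub>R fact n))"
proof -
  obtain K where K: "K > 0" "\<And>(X::complex^2^2) (Y::complex^2^2). norm (X ** Y) \<le> norm X * norm Y * K"
    using matrix_mult.pos_bounded by blast
  have bound: "norm ((((**) A) ^^ n) (mat 1)) \<le> norm (mat 1 :: complex^2^2) * (norm A * K) ^ n" for n
  proof (induction n)
    case (Suc n)
    have "norm ((((**) A) ^^ Suc n) (mat 1)) \<le> (norm A * K) * norm ((((**) A) ^^ n) (mat 1))"
      using K(2)[of A "(((**) A) ^^ n) (mat 1)"] by (simp add: mult_ac)
    also have "\<dots> \<le> (norm A * K) * (norm (mat 1 :: complex^2^2) * (norm A * K) ^ n)"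
      using Suc K(1) by (intro mult_left_mono) auto
    finally show ?case by (simp add: mult_ac)
  qed simp
  have "summable (\<lambda>n. norm (mat 1 :: complex^2^2) * (inverse (fact n) * (norm A * K) ^ n))"
    by (intro summable_mult summable_exp)
  then show ?thesis
  proof (rule summable_comparison_test')
    fix n :: nat
    show "norm (norm ((((**) A) ^^ n) (mat 1) /\<^sub>R fact n)) \<le>
        norm (mat 1 :: complex^2^2) * (inverse (fact n) * (norm A * K) ^ n)"
      using mult_left_mono[OF bound[of n], of "inverse (fact n)"] by (simp add: mult_ac)
  qed
qed

lemma mat_exp_0: "mat_exp 0 = mat 1"
proof -
  have "(((**) (0::complex^2^2)) ^^ n) (mat 1) /\<^sub>R fact n = (if n = 0 then mat 1 else 0)" for n
    by (cases n) (auto simp: matrix_mult.zero_left)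
  then have "mat_exp 0 = (\<Sum>n. if n = 0 then mat 1 else 0)"
    unfolding mat_exp_def by simp
  also have "\<dots> = (\<Sum>n\<in>{0}. if n = (0::nat) then mat 1 else 0)"
    by (rule suminf_finite) auto
  finally show ?thesis by simp
qed

lemma mat_exp_commute: "mat_exp A ** A = A ** mat_exp A"
proof -
  note s = summable_norm_cancel[OF summable_mat_exp[of A]]
  have "mat_exp A ** A = (\<Sum>n. ((((**) A) ^^ n) (mat 1) /\<^sub>R fact n) ** A)"
    unfolding mat_exp_def
    by (rule bounded_linear.suminf[OF matrix_mult.bounded_linear_left s])
  also have "\<dots> = (\<Sum>n. A ** ((((**) A) ^^ n) (mat 1) /\<^sub>R fact n))"
    by (simp add: matrix_mult.scaleR_left matrix_mult.scaleR_right mat_pow_commute)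
  also have "\<dots> = A ** mat_exp A"
    unfolding mat_exp_def
    by (rule bounded_linear.suminf[OF matrix_mult.bounded_linear_right s, symmetric])
  finally show ?thesis .
qed

lemma mat_exp_has_vector_derivative:
  "((\<lambda>t. mat_exp (t *\<^sub>R A)) has_vector_derivative (A ** mat_exp (t *\<^sub>R A))) (at t)"
proof -
  let ?P = "\<lambda>n. (((**) A) ^^ n) (mat 1)"
  have pw: "(((**) (s *\<^sub>R A)) ^^ n) (mat 1) /\<^sub>R fact n = (s ^ n / fact n) *\<^sub>R ?P n" for s n
    by (simp add: mat_pow_scale field_simps)
  have ser: "mat_exp (s *\<^sub>R A) $ i $ j = (\<Sum>n. (?P n $ i $ j / fact n) * of_real s ^ n)"
    and smr: "summable (\<lambda>n. (?P n $ i $ j / fact n) * of_real s ^ n)" for s i j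
  proof -
    note sm = summable_norm_cancel[OF summable_mat_exp[of "s *\<^sub>R A"]]
    have eq: "(\<lambda>n. ((((**) (s *\<^sub>R A)) ^^ n) (mat 1) /\<^sub>R fact n) $ i $ j) =
        (\<lambda>n. (?P n $ i $ j / fact n) * of_real s ^ n)"
      unfolding pw vector_scaleR_component by (simp only: scaleR_conv_of_real) (simp add: field_simps)
    show "mat_exp (s *\<^sub>R A) $ i $ j = (\<Sum>n. (?P n $ i $ j / fact n) * of_real s ^ n)"
      unfolding mat_exp_def bounded_linear.suminf[OF bounded_linear_matrix_entry sm] eq ..
    show "summable (\<lambda>n. (?P n $ i $ j / fact n) * of_real s ^ n)"
      using bounded_linear.summable[OF bounded_linear_matrix_entry sm, of i j] unfolding eq .
  qed
  have smz: "summable (\<lambda>n. (?P n $ i $ j / fact n) * z ^ n)" for i j and z :: complex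
  proof (rule powser_inside)
    show "summable (\<lambda>n. (?P n $ i $ j / fact n) * of_real (norm z + 1) ^ n)" by (rule smr)
  qed simp
  have dif: "diffs (\<lambda>n. ?P n $ i $ j / fact n) = (\<lambda>n. ?P (Suc n) $ i $ j / fact n)" for i j
    by (rule ext) (simp add: diffs_def del: of_nat_Suc)
  have der: "((\<lambda>s. mat_exp (s *\<^sub>R A) $ i $ j) has_vector_derivative ((A ** mat_exp (t *\<^sub>R A)) $ i $ j)) (at t)"
    for i j
  proof -
    have "A ** mat_exp (t *\<^sub>R A) = (\<Sum>n. A ** ((((**) (t *\<^sub>R A)) ^^ n) (mat 1) /\<^sub>R fact n))"
      unfolding mat_exp_def
      by (rule bounded_linear.suminf[OF matrix_mult.bounded_linear_right
            summable_norm_cancel[OF summable_mat_exp]])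
    also have "\<dots> = (\<Sum>n. (t ^ n / fact n) *\<^sub>R ?P (Suc n))"
      unfolding pw by (simp add: matrix_mult.scaleR_right)
    finally have "(A ** mat_exp (t *\<^sub>R A)) $ i $ j = (\<Sum>n. (t ^ n / fact n) *\<^sub>R ?P (Suc n)) $ i $ j"
      by simp
    also have "\<dots> = (\<Sum>n. ((t ^ n / fact n) *\<^sub>R ?P (Suc n)) $ i $ j)"
    proof (rule bounded_linear.suminf[OF bounded_linear_matrix_entry])
      have "summable (\<lambda>n. A ** ((((**) (t *\<^sub>R A)) ^^ n) (mat 1) /\<^sub>R fact n))"
        by (rule bounded_linear.summable[OF matrix_mult.bounded_linear_right
            summable_norm_cancel[OF summable_mat_exp]])
      then show "summable (\<lambda>n. (t ^ n / fact n) *\<^sub>R ?P (Suc n))"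
        unfolding pw by (simp add: matrix_mult.scaleR_right)
    qed
    also have "\<dots> = (\<Sum>n. diffs (\<lambda>n. ?P n $ i $ j / fact n) n * of_real t ^ n)"
      unfolding dif vector_scaleR_component by (simp only: scaleR_conv_of_real) (simp add: field_simps)
    finally have e: "(A ** mat_exp (t *\<^sub>R A)) $ i $ j =
        (\<Sum>n. diffs (\<lambda>n. ?P n $ i $ j / fact n) n * of_real t ^ n)" .
    show ?thesis
      unfolding ser e
      by (rule has_vector_derivative_real_field[OF termdiffs_strong_converges_everywhere[OF smz]])
  qed
  show ?thesis
    using der by (rule has_vector_derivative_entrywise)
qed

lemma mat_exp_neg_cancel: "mat_exp (- t *\<^sub>R A) ** mat_exp (t *\<^sub>R A) = mat 1"
proof -
  have 1: "((\<lambda>t. mat_exp (- t *\<^sub>R A)) has_vector_derivative (- (A ** mat_exp (- s *\<^sub>R A)))) (at s)" for s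
    using mat_exp_has_vector_derivative[of "- A" s] by (simp add: matrix_mult.minus_left)
  have com: "mat_exp (- s *\<^sub>R A) ** A = A ** mat_exp (- s *\<^sub>R A)" for s
    using mat_exp_commute[of "- s *\<^sub>R A"]
    by (cases "s = 0") (simp_all add: mat_exp_0 matrix_mult.scaleR_left matrix_mult.scaleR_right
       matrix_mult.minus_left matrix_mult.minus_right)
  have "((\<lambda>t. mat_exp (- t *\<^sub>R A) ** mat_exp (t *\<^sub>R A)) has_vector_derivative 0) (at s within UNIV)" for s
    using matrix_mult.has_vector_derivative[OF 1 mat_exp_has_vector_derivative[of A s]]
    by (simp only: com[of s] matrix_mul_assoc matrix_mult.minus_left) simp
  then obtain c where "\<And>t. mat_exp (- t *\<^sub>R A) ** mat_exp (t *\<^sub>R A) = c"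
    using has_vector_derivative_zero_constant[of UNIV "\<lambda>t. mat_exp (- t *\<^sub>R A) ** mat_exp (t *\<^sub>R A)"] by auto
  from this[of t] this[of 0] show ?thesis by (simp add: mat_exp_0)
qed

section \<open>One-parameter subgroups\<close>

definition one_param :: "complex^2^2 \<Rightarrow> real \<Rightarrow> complex^2^2" where
  "one_param A t = mat_exp (t *\<^sub>R A)"

lemma one_param_0 [simp]: "one_param A 0 = mat 1"
  by (simp add: one_param_def mat_exp_0)

lemma one_param_commute: "one_param A t ** A = A ** one_param A t"
proof (cases "t = 0")
  case False
  have "t *\<^sub>R (one_param A t ** A) = t *\<^sub>R (A ** one_param A t)"
    using mat_exp_commute[of "t *\<^sub>R A"]
    by (simp add: one_param_def matrix_mult.scaleR_left matrix_mult.scaleR_right)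
  with False show ?thesis by simp
qed simp

lemma one_param_deriv: "(one_param A has_vector_derivative A ** one_param A t) (at t)"
  unfolding one_param_def[abs_def] by (rule mat_exp_has_vector_derivative)

lemma one_param_minus: "one_param (- A) t = one_param A (- t)"
  by (simp add: one_param_def)

lemma one_param_deriv_neg:
  "((\<lambda>t. one_param A (- t)) has_vector_derivative - (A ** one_param A (- t))) (at t)"
  using one_param_deriv[of "- A" t] by (simp add: one_param_minus[abs_def] matrix_mult.minus_left)

lemma one_param_cancel: "one_param A (- t) ** one_param A t = mat 1" "one_param A t ** one_param A (- t) = mat 1"
  using mat_exp_neg_cancel[of t A] mat_exp_neg_cancel[of "- t" A] by (simp_all add: one_param_def)

text \<open>
  Together with \<open>one_param_commute_assoc\<close> these are rewrite rules for products bracketed to the left,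
  which is the normal form that \<open>matrix_mult_algebra\<close> produces.
\<close>

lemma one_param_cancel_assoc:
  "X ** one_param A (- t) ** one_param A t = X" "X ** one_param A t ** one_param A (- t) = X"
  by (simp_all add: one_param_cancel matrix_mul_assoc[symmetric])

lemma one_param_commute_assoc: "X ** one_param A t ** A = X ** A ** one_param A t"
  by (simp add: one_param_commute matrix_mul_assoc[symmetric])

lemma constant_if_zero_derivative:
  fixes X :: "real \<Rightarrow> 'a::real_normed_vector"
  assumes "\<And>t. (X has_vector_derivative 0) (at t)"
  shows "X t = X 0"
  using has_vector_derivative_zero_constant[of UNIV X] assms by (metis UNIV_I convex_UNIV)

lemmas matrix_mult_algebra = matrix_mul_assoc matrix_mult.add_left matrix_mult.add_right
  matrix_mult.diff_left matrix_mult.diff_right matrix_mult.minus_left matrix_mult.minus_right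

text \<open>
  Undoing the rotation makes the solution constant: \<open>exp (-tB) X exp (tB)\<close> has derivative zero.
\<close>

lemma bracket_ode_solution:
  assumes X: "\<And>t. (X has_vector_derivative lie_bracket B (X t)) (at t)"
  shows "X t = one_param B t ** X 0 ** one_param B (- t)"
proof -
  let ?Y = "\<lambda>t. one_param B (- t) ** X t ** one_param B t"
  have "(?Y has_vector_derivative 0) (at s)" for s
    using matrix_mult.has_vector_derivative[OF matrix_mult.has_vector_derivative[OF
        one_param_deriv_neg[of B s] X[of s]] one_param_deriv[of B s]]
    by (simp add: lie_bracket_def matrix_mult_algebra one_param_commute)
  then have "?Y t = X 0" using constant_if_zero_derivative[of ?Y t] by simp
  then have "one_param B t ** X 0 ** one_param B (- t) = one_param B t ** ?Y t ** one_param B (- t)"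
    by simp
  also have "\<dots> = X t" by (simp add: matrix_mult_algebra one_param_cancel one_param_cancel_assoc)
  finally show ?thesis by simp
qed

lemma conj_one_param_deriv:
  "((\<lambda>t. one_param B t ** C ** one_param B (- t)) has_vector_derivative
     lie_bracket B (one_param B t ** C ** one_param B (- t))) (at t)"
  using matrix_mult.has_vector_derivative[OF matrix_mult.has_vector_derivative[OF
        one_param_deriv[of B t] has_vector_derivative_const[of C]] one_param_deriv_neg[of B t]]
  by (simp add: lie_bracket_def matrix_mult_algebra one_param_commute_assoc matrix_mult.zero_right)

text \<open>
  The velocity of \<open>exp (t (C + B)) exp (-tB)\<close>, pulled back to the unit by a left shift, is the
  conjugate \<open>exp (tB) C exp (-tB)\<close>: the part \<open>B\<close> of the first generator is cancelled by the second
  factor.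
\<close>

lemma product_one_param_deriv:
  "((\<lambda>t. one_param (C + B) t ** one_param B (- t)) has_vector_derivative
     one_param (C + B) t ** one_param B (- t) ** (one_param B t ** C ** one_param B (- t))) (at t)"
  using matrix_mult.has_vector_derivative[OF one_param_deriv[of "C + B" t] one_param_deriv_neg[of B t]]
  unfolding one_param_commute[symmetric]
  by (simp add: matrix_mult_algebra one_param_cancel_assoc one_param_commute_assoc)

text \<open>
  The curve \<open>g exp (tB)\<close> satisfies \<open>h' = h (C + B)\<close> with constant coefficient, so
  \<open>g exp (tB) exp (-t (C + B))\<close> is constant.
\<close>

lemma left_shift_ode_solution:
  assumes g: "\<And>t. (g has_vector_derivative g t ** (one_param B t ** C ** one_param B (- t))) (at t)"
    and g0: "g 0 = mat 1"
  shows "g t = one_param (C + B) t ** one_param B (- t)"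
proof -
  let ?Y = "\<lambda>t. g t ** one_param B t ** one_param (C + B) (- t)"
  have "(?Y has_vector_derivative 0) (at s)" for s
    using matrix_mult.has_vector_derivative[OF matrix_mult.has_vector_derivative[OF
        g[of s] one_param_deriv[of B s]] one_param_deriv_neg[of "C + B" s]]
    by (simp add: matrix_mult_algebra one_param_cancel_assoc one_param_commute_assoc)
  then have "?Y t = mat 1" using constant_if_zero_derivative[of ?Y t] g0 by simp
  then have "one_param (C + B) t ** one_param B (- t) = ?Y t ** one_param (C + B) t ** one_param B (- t)"
    by simp
  then show ?thesis by (simp add: one_param_cancel_assoc)
qed

text \<open>
  By Jacobi's formula \<open>det\<close> satisfies the scalar equation with coefficient \<open>trace A\<close>. A real trace
  therefore keeps the curve in \<open>GL_plus\<close>.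
\<close>

lemma det_one_param: "det (one_param A t) = exp (of_real t * trace A)"
proof -
  let ?E = "one_param A"
  let ?f = "\<lambda>t. det (?E t) * exp (- (of_real t * trace A))"
  have ent: "((\<lambda>t. ?E t $ i $ j) has_vector_derivative (A ** ?E s) $ i $ j) (at s)" for i j s
    by (rule bounded_linear.has_vector_derivative[OF bounded_linear_matrix_entry one_param_deriv])
  have ex: "((\<lambda>t. exp (- (of_real t * trace A))) has_vector_derivative
      - trace A * exp (- (of_real s * trace A))) (at s)" for s
    by (rule has_vector_derivative_real_field) (auto intro!: derivative_eq_intros)
  have "(?f has_vector_derivative 0) (at s)" for s
    unfolding det_2
    using has_vector_derivative_mult[OF has_vector_derivative_diff[OF
        has_vector_derivative_mult[OF ent[of 1 1 s] ent[of 2 2 s]]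
        has_vector_derivative_mult[OF ent[of 1 2 s] ent[of 2 1 s]]] ex[of s]]
    by (rule has_vector_derivative_eq_rhs)
      (simp add: matrix_matrix_mult_def sum_2 trace_def algebra_simps)
  then have "?f t = 1" using constant_if_zero_derivative[of ?f t] by (simp add: det_I)
  then show ?thesis by (simp add: exp_minus field_simps)
qed

section \<open>Hermitian and skew-Hermitian parts\<close>

definition adj :: "complex^2^2 \<Rightarrow> complex^2^2" where
  "adj A = (\<chi> i j. cnj (A $ j $ i))"

lemma adj_nth [simp]: "adj A $ i $ j = cnj (A $ j $ i)"
  by (simp add: adj_def)

lemma adj_adj [simp]: "adj (adj A) = A"
  by (simp add: vec_eq_iff)

lemma adj_mult: "adj (A ** B) = adj B ** adj A"
  by (simp add: vec_eq_iff matrix_matrix_mult_def mult.commute)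

lemma bounded_linear_adj: "bounded_linear adj"
  unfolding linear_conv_bounded_linear[symmetric]
  by (rule linearI) (simp_all add: vec_eq_iff)

lemma adj_add: "adj (A + B) = adj A + adj B"
  and adj_diff: "adj (A - B) = adj A - adj B"
  and adj_minus: "adj (- A) = - adj A"
  and adj_scaleR: "adj (c *\<^sub>R A) = c *\<^sub>R adj A"
  by (simp_all add: vec_eq_iff)

lemma adj_mat_1 [simp]: "adj (mat 1) = mat 1"
  by (auto simp: vec_eq_iff mat_def)

lemma trace_adj [simp]: "trace (adj A) = cnj (trace A)"
  by (simp add: trace_def)

lemma horizontal_space_iff_adj: "A \<in> horizontal_space \<longleftrightarrow> adj A = A"
proof -
  have "adj A = A \<longleftrightarrow> (\<forall>i j. A $ i $ j = adj A $ i $ j)"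
    by (metis vec_eq_iff)
  then show ?thesis unfolding horizontal_space_hermitian adj_nth by blast
qed

lemma adj_one_param: "adj (one_param A t) = one_param (adj A) t"
proof -
  have pow: "adj ((((**) X) ^^ n) (mat 1)) = (((**) (adj X)) ^^ n) (mat 1)" for X n
    by (induction n) (simp_all add: adj_mult mat_pow_commute)
  show ?thesis
    unfolding one_param_def mat_exp_def
    by (subst bounded_linear.suminf[OF bounded_linear_adj summable_norm_cancel[OF summable_mat_exp]])
      (simp add: adj_scaleR pow)
qed

lemma inner_mat2: "(A :: complex^2^2) \<bullet> B =
    A$1$1 \<bullet> B$1$1 + A$1$2 \<bullet> B$1$2 + A$2$1 \<bullet> B$2$1 + A$2$2 \<bullet> B$2$2"
  by (simp add: inner_vec_def sum_2)

lemma inner_adj: "adj A \<bullet> B = A \<bullet> adj B"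
  by (simp add: inner_mat2 inner_complex_def)

lemma inner_mult_left: "X \<bullet> (A ** Y) = (adj A ** X) \<bullet> Y" for A X Y :: "complex^2^2"
  by (simp add: inner_mat2 inner_complex_def matrix_matrix_mult_def sum_2 algebra_simps)

lemma inner_mult_right: "X \<bullet> (Y ** A) = (X ** adj A) \<bullet> Y" for A X Y :: "complex^2^2"
  by (simp add: inner_mat2 inner_complex_def matrix_matrix_mult_def sum_2 algebra_simps)

lemma gl_basis_0: "gl_basis 0 = (1/2) *\<^sub>R mat 1"
  by (simp add: gl_basis_def vec_eq_iff forall_2 mat_def)

definition herm_part :: "complex^2^2 \<Rightarrow> complex^2^2" where
  "herm_part A = (1/2) *\<^sub>R (A + adj A)"

definition skew_part :: "complex^2^2 \<Rightarrow> complex^2^2" where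
  "skew_part A = (1/2) *\<^sub>R (A - adj A)"

lemma herm_part_adj [simp]: "adj (herm_part A) = herm_part A"
  by (simp add: herm_part_def adj_scaleR adj_add add.commute)

lemma skew_part_adj [simp]: "adj (skew_part A) = - skew_part A"
  by (simp add: skew_part_def adj_scaleR adj_diff flip: scaleR_minus_right)

lemma herm_plus_skew: "A = herm_part A + skew_part A"
  by (simp add: herm_part_def skew_part_def algebra_simps flip: scaleR_left_distrib)

lemma bounded_linear_herm_part: "bounded_linear herm_part"
  unfolding herm_part_def[abs_def]
  by (intro bounded_linear_add bounded_linear_ident bounded_linear_adj
      bounded_linear_compose[OF bounded_linear_scaleR_right])

lemma bounded_linear_skew_part: "bounded_linear skew_part"
  unfolding skew_part_def[abs_def]
  by (intro bounded_linear_sub bounded_linear_ident bounded_linear_adj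
      bounded_linear_compose[OF bounded_linear_scaleR_right])

lemma parts_unique:
  assumes "adj P = P" "adj K = - K"
  shows "herm_part (P + K) = P" "skew_part (P + K) = K"
  using assms by (simp_all add: herm_part_def skew_part_def adj_add flip: scaleR_2)

lemma adj_lie_bracket: "adj P = P \<Longrightarrow> adj (lie_bracket P X) = - lie_bracket P (adj X)"
  by (simp add: lie_bracket_def adj_diff adj_mult)

lemma lie_bracket_simps:
  "lie_bracket A (X + Y) = lie_bracket A X + lie_bracket A Y"
  "lie_bracket A (- X) = - lie_bracket A X"
  "lie_bracket A A = 0"
  by (simp_all add: lie_bracket_def matrix_mult_algebra)

text \<open>
  The commutator of a Hermitian matrix \<open>P\<close> with a skew-Hermitian matrix \<open>K\<close> is Hermitian, and
  \<open>[P, P] = 0\<close>. Applied to the costate equation \<open>\<psi>' = [P, \<psi>]\<close>, this makes the skew-Hermitian part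
  of \<open>\<psi>\<close> a first integral and leaves a linear equation for the Hermitian part.
\<close>

lemma parts_of_bracket_herm_part:
  "herm_part (lie_bracket (herm_part X) X) = lie_bracket (- skew_part X) (herm_part X)"
  "skew_part (lie_bracket (herm_part X) X) = 0"
proof -
  let ?P = "herm_part X" and ?K = "skew_part X"
  have "lie_bracket ?P X = lie_bracket ?P ?K + 0"
    using lie_bracket_simps(1)[of ?P ?P ?K] herm_plus_skew[of X] by (simp add: lie_bracket_simps(3))
  moreover have "adj (lie_bracket ?P ?K) = lie_bracket ?P ?K"
    by (simp add: adj_lie_bracket lie_bracket_simps)
  moreover have "lie_bracket ?P ?K = lie_bracket (- ?K) ?P"
    by (simp add: lie_bracket_def matrix_mult_algebra)
  moreover have "adj 0 = - 0" by (simp add: vec_eq_iff)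
  ultimately show "herm_part (lie_bracket ?P X) = lie_bracket (- ?K) ?P" "skew_part (lie_bracket ?P X) = 0"
    using parts_unique[of "lie_bracket ?P ?K" 0] by (simp_all only:)
qed

section \<open>The pseudoscalar product in coordinate-free form\<close>

lemma trace_scaleR: "trace (c *\<^sub>R A) = c *\<^sub>R trace A" for A :: "complex^2^2"
  by (simp add: trace_def sum_2 scaleR_right_distrib)

lemma trace_gl_basis_0 [simp]: "trace (gl_basis 0) = 1"
  by (simp add: gl_basis_0 trace_scaleR) (simp add: trace_def sum_2 mat_def complex_eq_iff)

lemma adj_gl_basis_0 [simp]: "adj (gl_basis 0) = gl_basis 0"
  by (simp add: gl_basis_0 adj_scaleR)

lemma inner_gl_basis_0: "gl_basis 0 \<bullet> X = Re (trace X) / 2"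
  by (simp add: inner_mat2 inner_complex_def gl_basis_0 trace_def sum_2 mat_def)

lemma trace_sum_gl_basis: "trace (\<Sum>k=0..6. c k *\<^sub>R gl_basis k) = of_real (c 0)"
  unfolding sum_gl_basis by (simp add: trace_def sum_2 complex_eq_iff add_divide_distrib diff_divide_distrib)

lemma inner_sum_gl_basis:
  "(\<Sum>k=0..6. c k *\<^sub>R gl_basis k) \<bullet> (\<Sum>k=0..6. d k *\<^sub>R gl_basis k) = (\<Sum>k=0..6. c k * d k) / 2"
  unfolding sum_gl_basis
  by (simp add: inner_mat2 inner_complex_def atLeast0AtMost_6 field_simps)

lemma lie_form_sum_gl_basis:
  "lie_form (\<Sum>k=0..6. c k *\<^sub>R gl_basis k) (\<Sum>k=0..6. d k *\<^sub>R gl_basis k) =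
    c 0 * d 0 - (\<Sum>k=1..6. c k * d k)"
proof -
  let ?X = "\<Sum>k=0..6. c k *\<^sub>R gl_basis k" and ?Y = "\<Sum>k=0..6. d k *\<^sub>R gl_basis k"
  have *: "gl_coord k ?X * gl_coord k ?Y = c k * d k" if "k \<in> {0..6}" for k
    by (simp only: gl_coord_sum[OF that])
  have "(\<Sum>k=1..6. gl_coord k ?X * gl_coord k ?Y) = (\<Sum>k=1..6. c k * d k)"
    by (rule sum.cong[OF refl], rule *) simp
  moreover have "gl_coord 0 ?X * gl_coord 0 ?Y = c 0 * d 0" by (rule *) simp
  ultimately show ?thesis unfolding lie_form_def by (simp only:)
qed

text \<open>
  The inner product of \<open>complex^2^2\<close> makes \<open>e\<^sub>0, ..., e\<^sub>6\<close> orthogonal with squared norm \<open>1/2\<close>, so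
  \<open>- 2 (X \<bullet> Y)\<close> is the negative definite form in all seven coordinates. Since \<open>tr X\<close> is the
  coordinate of index 0, the first term turns the sign of that coordinate.
\<close>

lemma lie_form_eq:
  assumes "X \<in> gl_plus" "Y \<in> gl_plus"
  shows "lie_form X Y = 2 * Re (trace X) * Re (trace Y) - 2 * (X \<bullet> Y)"
proof -
  obtain c where c: "X = (\<Sum>k=0..6. c k *\<^sub>R gl_basis k)"
    using assms(1) by (rule gl_plus_expand)
  obtain d where d: "Y = (\<Sum>k=0..6. d k *\<^sub>R gl_basis k)"
    using assms(2) by (rule gl_plus_expand)
  have "(\<Sum>k=0..6::nat. c k * d k) = c 0 * d 0 + (\<Sum>k=1..6. c k * d k)"
    by (subst sum.atLeast_Suc_atMost) auto
  then show ?thesis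
    unfolding c d lie_form_sum_gl_basis trace_sum_gl_basis inner_sum_gl_basis by (simp add: field_simps)
qed

lemma gl_basis_in_gl_plus: "k \<le> 6 \<Longrightarrow> gl_basis k \<in> gl_plus"
  unfolding gl_plus_eq_span by (intro span_base imageI) simp

text \<open>
  The basis is orthogonal for the pseudoscalar product with squares \<open>1, -1, ..., -1\<close>. Hence a curve in
  \<open>gl_plus\<close> can be differentiated through its pairings with the basis.
\<close>

lemma gl_plus_reconstruct:
  assumes "X \<in> gl_plus"
  shows "X = (\<Sum>k=0..6. ((if k = 0 then 1 else -1) * lie_form X (gl_basis k)) *\<^sub>R gl_basis k)"
proof -
  obtain c where c: "X = (\<Sum>k=0..6. c k *\<^sub>R gl_basis k)"
    using assms by (rule gl_plus_expand)
  have "(if k = 0 then 1 else -1) * lie_form X (gl_basis k) = c k" if k: "k \<in> {0..6}" for k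
  proof -
    have "gl_basis k = (\<Sum>j=0..6. (if j = k then 1 else 0) *\<^sub>R gl_basis j)"
      using k by (simp add: if_distrib[of "\<lambda>x. x *\<^sub>R _"] cong: if_cong)
    then have "lie_form X (gl_basis k) = lie_form (\<Sum>j=0..6. c j *\<^sub>R gl_basis j) (\<Sum>j=0..6. (if j = k then 1 else 0) *\<^sub>R gl_basis j)"
      using c by (simp only:)
    also have "\<dots> = c 0 * (if 0 = k then 1 else 0) - (\<Sum>j=1..6. c j * (if j = k then 1 else 0))"
      by (rule lie_form_sum_gl_basis)
    finally have "lie_form X (gl_basis k) = c 0 * (if 0 = k then 1 else 0) - (\<Sum>j=1..6. c j * (if j = k then 1 else 0))" .
    then show ?thesis using k by (auto simp: if_distrib[of "\<lambda>x. _ * x"] cong: if_cong)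
  qed
  then show ?thesis using c by simp
qed

lemma trace_lie_bracket [simp]: "trace (lie_bracket A B) = 0"
  by (simp add: lie_bracket_def trace_sub trace_mul_sym[of A B])

lemma lie_bracket_in_gl_plus: "lie_bracket A B \<in> gl_plus"
  by (simp add: gl_plus_def)

lemma horizontal_space_subset_gl_plus: "horizontal_space \<subseteq> gl_plus"
  unfolding horizontal_space_def gl_plus_eq_span by (intro span_mono image_mono) auto

text \<open>
  For Hermitian \<open>u\<close> the map \<open>v \<mapsto> [u, v]\<close> is symmetric, because left and right multiplication by \<open>u\<close>
  are symmetric for the real inner product and commutators have trace zero.
\<close>

lemma lie_form_bracket:
  assumes u: "u \<in> horizontal_space" and "X \<in> gl_plus" "v \<in> gl_plus"
  shows "lie_form X (lie_bracket u v) = lie_form (lie_bracket u X) v"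
proof -
  have "X \<bullet> lie_bracket u v = lie_bracket u X \<bullet> v"
    using u by (simp add: horizontal_space_iff_adj lie_bracket_def inner_diff_left inner_diff_right
       inner_mult_left[of X u v] inner_mult_right[of X v u])
  then show ?thesis using assms by (simp add: lie_form_eq lie_bracket_in_gl_plus)
qed

lemma costate_vector_derivative:
  assumes psi: "\<And>s. \<psi> s \<in> gl_plus" and u: "u \<in> horizontal_space"
    and der: "\<And>v. v \<in> gl_plus \<Longrightarrow> ((\<lambda>s. lie_form (\<psi> s) v) has_real_derivative
                            lie_form (\<psi> t) (lie_bracket u v)) (at t)"
  shows "(\<psi> has_vector_derivative lie_bracket u (\<psi> t)) (at t)"
proof -
  have "((\<lambda>s. \<Sum>k=0..6. ((if k = 0 then 1 else -1) * lie_form (\<psi> s) (gl_basis k)) *\<^sub>R gl_basis k)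
    has_vector_derivative (\<Sum>k=0..6. ((if k = 0 then 1 else -1) * lie_form (lie_bracket u (\<psi> t)) (gl_basis k)) *\<^sub>R gl_basis k)) (at t)"
  proof (rule has_vector_derivative_sum)
    fix k :: nat assume "k \<in> {0..6}"
    then have k: "gl_basis k \<in> gl_plus" by (simp add: gl_basis_in_gl_plus)
    have "((\<lambda>s. lie_form (\<psi> s) (gl_basis k)) has_vector_derivative
        lie_form (lie_bracket u (\<psi> t)) (gl_basis k)) (at t)"
      using der[OF k] by (simp add: has_real_derivative_iff_has_vector_derivative lie_form_bracket[OF u psi k])
    from has_vector_derivative_mult_right[OF this, of "if k = 0 then 1 else -1"]
    show "((\<lambda>s. ((if k = 0 then 1 else -1) * lie_form (\<psi> s) (gl_basis k)) *\<^sub>R gl_basis k)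
        has_vector_derivative ((if k = 0 then 1 else -1) * lie_form (lie_bracket u (\<psi> t)) (gl_basis k)) *\<^sub>R gl_basis k) (at t)"
      by (rule bounded_linear.has_vector_derivative[OF bounded_linear_scaleR_left])
  qed
  then show ?thesis
    unfolding gl_plus_reconstruct[OF psi, symmetric] gl_plus_reconstruct[OF lie_bracket_in_gl_plus, symmetric] .
qed

lemma trace_skew_part:
  assumes "X \<in> gl_plus" shows "trace (skew_part X) = 0"
  using assms by (simp add: skew_part_def trace_scaleR trace_sub gl_plus_def Reals_cnj_iff)

section \<open>The minimum condition\<close>

lemma unit_directions_iff:
  "w \<in> unit_directions \<longleftrightarrow> adj w = w \<and> trace w = 0 \<and> w \<bullet> w = 1/2"
proof (cases "adj w = w")
  case True
  then have w: "w \<in> horizontal_space" "w \<in> gl_plus"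
    using horizontal_space_iff_adj horizontal_space_subset_gl_plus by blast+
  have tr: "trace w = 0 \<longleftrightarrow> Re (trace w) = 0"
    using w(2) by (simp add: gl_plus_def complex_is_Real_iff complex_eq_iff)
  show ?thesis
    using True w tr by (auto simp: unit_directions_def lie_form_eq gl_basis_in_gl_plus
        inner_gl_basis_0 inner_commute[of w "gl_basis 0"])
qed (simp add: unit_directions_def horizontal_space_iff_adj)

lemma lie_form_gl_basis_0: "X \<in> gl_plus \<Longrightarrow> lie_form X (gl_basis 0) = Re (trace X)"
  by (simp add: lie_form_eq gl_basis_in_gl_plus inner_commute[of X] inner_gl_basis_0)

text \<open>
  A direction is Hermitian and traceless, hence orthogonal to the skew-Hermitian matrices and to
  \<open>e\<^sub>0\<close>. On directions the covector acts through the remaining part of \<open>X\<close> only.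
\<close>

lemma lie_form_unit_direction:
  assumes X: "X \<in> gl_plus" and w: "w \<in> unit_directions"
  shows "lie_form X w = - 2 * ((herm_part X - gl_basis 0) \<bullet> w)"
proof -
  have w': "adj w = w" "trace w = 0" using w by (auto simp: unit_directions_iff)
  then have "w \<in> gl_plus" by (simp add: gl_plus_def)
  moreover have "adj X \<bullet> w = X \<bullet> w" using w' by (simp add: inner_adj)
  ultimately show ?thesis
    using w' X by (simp add: lie_form_eq herm_part_def inner_diff_left inner_gl_basis_0 inner_add_left)
qed

text \<open>
  With \<open>q = herm_part X - e\<^sub>0\<close> the covector is \<open>-2 (q \<bullet> w)\<close> on the sphere \<open>w \<bullet> w = 1/2\<close>. Comparing
  \<open>w\<close> with the direction of \<open>q\<close> bounds \<open>q \<bullet> q\<close> by \<open>1/2\<close>, and then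
  \<open>(q - w) \<bullet> (q - w) = q \<bullet> q - 1 + 1/2\<close> leaves only \<open>q = w\<close>.
\<close>

lemma arg_min_unit_directionsD:
  assumes X: "X \<in> gl_plus" "lie_form X (gl_basis 0) = 1" and w: "w \<in> unit_directions"
    and min: "is_arg_min (lie_form X) (\<lambda>w'. w' \<in> unit_directions) w" "lie_form X w = -1"
  shows "gl_basis 0 + w = herm_part X"
proof -
  define q where "q = herm_part X - gl_basis 0"
  have tr: "trace X = 1"
    using X by (simp add: lie_form_gl_basis_0 gl_plus_def complex_is_Real_iff complex_eq_iff)
  have q: "adj q = q" "trace q = 0"
    by (simp_all add: q_def herm_part_def adj_diff adj_scaleR adj_add trace_sub trace_add trace_scaleR tr add.commute complex_eq_iff)
  have ww: "w \<bullet> w = 1/2" using w by (simp add: unit_directions_iff)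
  have qw: "q \<bullet> w = 1/2"
    using min(2) lie_form_unit_direction[OF X(1) w] by (simp add: q_def)
  then have q0: "q \<noteq> 0" by auto
  \<comment> \<open>This factor scales \<open>q\<close> to the radius of the sphere, whose squared norm is \<open>1/2\<close>.\<close>
  define c where "c = 1 / (sqrt 2 * norm q)"
  have "c\<^sup>2 * (q \<bullet> q) = 1/2"
    using q0 by (simp add: c_def power_divide power_mult_distrib power2_norm_eq_inner)
  then have cq: "c *\<^sub>R q \<in> unit_directions"
    using q by (simp add: unit_directions_iff adj_scaleR trace_scaleR power2_eq_square mult.assoc)
  have "\<not> lie_form X (c *\<^sub>R q) < lie_form X w"
    using min(1) cq by (simp add: is_arg_min_def)
  then have "2 * (c * (q \<bullet> q)) \<le> 1"
    using lie_form_unit_direction[OF X(1) cq] min(2) by (simp add: q_def)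
  moreover have "2 * (c * (q \<bullet> q)) = norm q * (2 / sqrt 2)"
    using q0 by (simp add: c_def power2_norm_eq_inner[symmetric] power2_eq_square)
  ultimately have "sqrt 2 * norm q \<le> 1"
    by (simp add: real_div_sqrt mult.commute)
  then have "(sqrt 2 * norm q)\<^sup>2 \<le> 1" by (simp add: power_le_one)
  then have "2 * (q \<bullet> q) \<le> 1" by (simp add: power_mult_distrib power2_norm_eq_inner)
  then have "(q - w) \<bullet> (q - w) \<le> 0"
    using qw ww by (simp add: inner_diff_left inner_diff_right inner_commute[of w q])
  then have "w = q" by (metis inner_gt_zero_iff linorder_not_less right_minus_eq)
  then show ?thesis by (simp only: q_def) simp
qed

lemma arg_min_unit_directionsI:
  assumes X: "X \<in> gl_plus" and w: "herm_part X = gl_basis 0 + w" "w \<in> unit_directions"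
  shows "is_arg_min (lie_form X) (\<lambda>w'. w' \<in> unit_directions) w" "lie_form X w = -1"
proof -
  have ww: "w \<bullet> w = 1/2" using w by (simp add: unit_directions_iff)
  have form: "lie_form X w' = - 2 * (w \<bullet> w')" if "w' \<in> unit_directions" for w'
    using lie_form_unit_direction[OF X that] w(1) by simp
  show 1: "lie_form X w = -1" using form[OF w(2)] ww by simp
  have "\<not> lie_form X w' < lie_form X w" if w': "w' \<in> unit_directions" for w'
  proof -
    have "0 \<le> (w - w') \<bullet> (w - w')" by simp
    then have "2 * (w \<bullet> w') \<le> 1"
      using ww w' by (simp add: unit_directions_iff inner_diff_left inner_diff_right inner_commute[of w' w])
    then show ?thesis using form[OF w'] 1 by simp
  qed
  then show "is_arg_min (lie_form X) (\<lambda>w'. w' \<in> unit_directions) w"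
    using w(2) by (auto simp: is_arg_min_def)
qed

text \<open>
  The exponential of a skew-Hermitian matrix is unitary, and unitary conjugation preserves the
  Hermitian symmetry, the trace and the norm.
\<close>

lemma unit_directions_conj:
  assumes B: "adj B = - B" and w: "w \<in> unit_directions"
  shows "one_param B t ** w ** one_param B (- t) \<in> unit_directions"
proof -
  have a: "adj (one_param B s) = one_param B (- s)" for s
    by (simp add: adj_one_param B one_param_minus)
  let ?U = "one_param B t" and ?V = "one_param B (- t)"
  have "trace (?U ** w ** ?V) = trace (?V ** (?U ** w))" by (rule trace_mul_sym)
  also have "\<dots> = trace w" by (simp add: matrix_mult_algebra one_param_cancel)
  finally have "trace (?U ** w ** ?V) = trace w" .
  moreover have "(?U ** w ** ?V) \<bullet> (?U ** w ** ?V) = w \<bullet> w"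
    unfolding inner_mult_right[of _ "?U ** w" ?V] inner_mult_left[of _ ?U w] a minus_minus
    by (simp add: matrix_mult_algebra one_param_cancel one_param_cancel_assoc)
  moreover have "adj (?U ** w ** ?V) = ?U ** w ** ?V"
    using w by (simp add: adj_mult a unit_directions_iff matrix_mult_algebra)
  ultimately show ?thesis using w by (simp add: unit_directions_iff)
qed

section \<open>Extremals as products of two one-parameter subgroups\<close>

text \<open>
  The necessary conditions identify the control with the Hermitian part of the costate. The matrix
  \<open>B\<close> of the theorem is the negative of the conserved skew-Hermitian part.
\<close>

lemma normal_isotropic_extremal_imp_product:
  assumes ext: "normal_isotropic_extremal g" and g0: "g 0 = mat 1"
  shows "\<exists>a B. a \<in> unit_directions \<and> adj B = - B \<and> trace B = 0 \<and>
    (\<forall>t. g t = one_param (gl_basis 0 + a + B) t ** one_param B (- t))"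
proof -
  obtain u w \<psi> where hc: "horizontal_curve g u"
    and w: "AE t in lebesgue. w t \<in> unit_directions \<and> u t = gl_basis 0 + w t"
    and psi: "\<And>t. \<psi> t \<in> gl_plus" and ac: "\<And>a b. absolutely_continuous_on {a..b} \<psi>"
    and psi0: "\<And>t. lie_form (\<psi> t) (gl_basis 0) = 1"
    and pmp: "AE t in lebesgue.
           (\<forall>v\<in>gl_plus. ((\<lambda>s. lie_form (\<psi> s) v) has_real_derivative
                            lie_form (\<psi> t) (lie_bracket (u t) v)) (at t)) \<and>
           is_arg_min (lie_form (\<psi> t)) (\<lambda>w'. w' \<in> unit_directions) (w t) \<and>
           lie_form (\<psi> t) (w t) = -1"
    using ext unfolding normal_isotropic_extremal_def by blast
  have lip: "\<And>a b. \<exists>L. L-lipschitz_on {a..b} g"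
    and gder: "AE t in lebesgue. u t \<in> horizontal_space \<and> (g has_vector_derivative (g t ** u t)) (at t)"
    using hc unfolding horizontal_curve_def by blast+
  let ?P = "\<lambda>t. herm_part (\<psi> t)" and ?K = "\<lambda>t. skew_part (\<psi> t)"
  have ae: "AE t in lebesgue. ?P t - gl_basis 0 \<in> unit_directions \<and>
      (\<psi> has_vector_derivative lie_bracket (?P t) (\<psi> t)) (at t) \<and>
      (g has_vector_derivative g t ** ?P t) (at t)"
    using w pmp gder
  proof eventually_elim
    case (elim t)
    then have P: "gl_basis 0 + w t = ?P t"
      by (intro arg_min_unit_directionsD psi psi0) blast+
    have "(\<psi> has_vector_derivative lie_bracket (u t) (\<psi> t)) (at t)"
      by (rule costate_vector_derivative[OF psi]) (use elim in blast)+
    moreover have "u t = ?P t" using elim P by metis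
    moreover have "?P t - gl_basis 0 = w t" using P by (metis add_diff_cancel_left')
    ultimately show ?case using elim by metis
  qed
  have cont: "continuous_on UNIV f" if "\<And>a b. absolutely_continuous_on {a..b} f" for f :: "real \<Rightarrow> complex^2^2"
  proof (rule continuous_at_imp_continuous_on, rule ballI)
    fix t :: real
    have "continuous_on {t - 1..t + 1} f"
      by (rule absolutely_continuous_on_imp_continuous_on[OF that])
    then show "isCont f t" by (rule continuous_on_interior) simp
  qed
  have acg: "absolutely_continuous_on {a..b} g" for a b
    using lip[of a b] absolutely_continuous_on_lipschitz by blast
  note cpsi = cont[OF ac] and cg = cont[OF acg]
  have cP: "continuous_on UNIV ?P"
    by (rule bounded_linear.continuous_on[OF bounded_linear_herm_part cpsi])
  have dpsi: "(\<psi> has_vector_derivative lie_bracket (?P t) (\<psi> t)) (at t)" for t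
  proof (rule absolutely_continuous_on_imp_C1[OF ac])
    show "AE t in lebesgue. (\<psi> has_vector_derivative lie_bracket (?P t) (\<psi> t)) (at t)"
      using ae by eventually_elim simp
    show "continuous_on UNIV (\<lambda>t. lie_bracket (?P t) (\<psi> t))"
      unfolding lie_bracket_def
      by (intro continuous_on_diff matrix_mult.continuous_on cP cpsi)
  qed
  have dg: "(g has_vector_derivative g t ** ?P t) (at t)" for t
  proof (rule absolutely_continuous_on_imp_C1[OF acg])
    show "AE t in lebesgue. (g has_vector_derivative g t ** ?P t) (at t)"
      using ae by eventually_elim simp
    show "continuous_on UNIV (\<lambda>t. g t ** ?P t)"
      by (intro matrix_mult.continuous_on cP cg)
  qed
  have "(?K has_vector_derivative 0) (at t)" for t
    using bounded_linear.has_vector_derivative[OF bounded_linear_skew_part dpsi[of t]]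
    by (simp add: parts_of_bracket_herm_part)
  then have K: "?K t = ?K 0" for t by (rule constant_if_zero_derivative)
  define B where "B = - ?K 0"
  have B: "adj B = - B" "trace B = 0"
    using trace_skew_part[OF psi] by (simp_all add: B_def adj_minus trace_def sum_2 add_eq_0_iff)
  have "(?P has_vector_derivative lie_bracket B (?P t)) (at t)" for t
    using bounded_linear.has_vector_derivative[OF bounded_linear_herm_part dpsi[of t]]
    by (simp add: parts_of_bracket_herm_part K[of t] B_def)
  then have P: "?P t = one_param B t ** ?P 0 ** one_param B (- t)" for t
    by (rule bracket_ode_solution)
  then have g: "g t = one_param (?P 0 + B) t ** one_param B (- t)" for t
    using dg g0 by (intro left_shift_ode_solution) metis+
  \<comment> \<open>The normalization of the initial direction is known at almost every time; the rotation carries it from one such time to 0.\<close>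
  obtain s where s: "?P s - gl_basis 0 \<in> unit_directions"
    using AE_lebesgue_witness[OF ae] by blast
  have "one_param B (- s) ** (?P s - gl_basis 0) ** one_param B (- (- s)) = ?P 0 - gl_basis 0"
    unfolding P[of s]
    by (simp add: matrix_mult_algebra one_param_cancel one_param_cancel_assoc gl_basis_0
        matrix_mult.scaleR_left matrix_mult.scaleR_right)
  then have "?P 0 - gl_basis 0 \<in> unit_directions"
    using unit_directions_conj[OF B(1) s, of "- s"] by metis
  with B g show ?thesis
    by (intro exI[of _ "?P 0 - gl_basis 0"] exI[of _ B]) simp
qed

text \<open>
  The costate is \<open>u - B\<close>. It solves the costate equation because \<open>u' = [B, u] = [u, u - B]\<close>, and its
  Hermitian part is the control, which is what the minimum condition asks for.
\<close>

lemma product_imp_normal_isotropic_extremal: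
  assumes a: "a \<in> unit_directions" and B: "adj B = - B" "trace B = 0"
    and g: "\<And>t. g t = one_param (gl_basis 0 + a + B) t ** one_param B (- t)"
  shows "normal_isotropic_extremal g" "g 0 = mat 1"
proof -
  define w where "w t = one_param B t ** a ** one_param B (- t)" for t
  define u where "u t = gl_basis 0 + w t" for t
  define \<psi> where "\<psi> t = u t - B" for t
  have w: "w t \<in> unit_directions" for t
    unfolding w_def by (rule unit_directions_conj[OF B(1) a])
  have u_eq: "u t = one_param B t ** (gl_basis 0 + a) ** one_param B (- t)" for t
    by (simp add: u_def w_def matrix_mult_algebra one_param_cancel one_param_cancel_assoc gl_basis_0
        matrix_mult.scaleR_left matrix_mult.scaleR_right)
  have adju: "adj (u t) = u t" and tru: "trace (u t) = 1" for t
    using w[of t] by (simp_all add: u_def adj_add trace_add unit_directions_iff)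
  have u_hor: "u t \<in> horizontal_space" and u_gl: "u t \<in> gl_plus" for t
    using adju tru by (simp_all add: horizontal_space_iff_adj gl_plus_def)
  have psi: "\<psi> t \<in> gl_plus" for t
    using tru[of t] B(2) by (simp add: \<psi>_def gl_plus_def trace_sub)
  have du: "(u has_vector_derivative lie_bracket B (u t)) (at t)" for t
    using conj_one_param_deriv[of B "gl_basis 0 + a" t] unfolding u_eq[symmetric] u_eq[abs_def, symmetric] .
  have cu: "continuous_on UNIV u"
    using has_vector_derivative_continuous[OF du] by (simp add: continuous_on_eq_continuous_at)
  have dpsi: "(\<psi> has_vector_derivative lie_bracket (u t) (\<psi> t)) (at t)" for t
    unfolding \<psi>_def[abs_def]
    by (rule has_vector_derivative_eq_rhs[OF has_vector_derivative_diff[OF du has_vector_derivative_const]])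
      (simp add: lie_bracket_def matrix_mult_algebra)
  have dg: "(g has_vector_derivative g t ** u t) (at t)" for t
    using product_one_param_deriv[of "gl_basis 0 + a" B t]
    unfolding g[symmetric] u_eq[symmetric] .
  have lip: "\<exists>L. L-lipschitz_on {c..d} X"
    if "\<And>t. (X has_vector_derivative F t) (at t)" "continuous_on UNIV F" for X F :: "real \<Rightarrow> complex^2^2" and c d
    by (rule C1_imp_lipschitz_on[OF has_vector_derivative_at_within[OF that(1)]
          continuous_on_subset[OF that(2) subset_UNIV]])
  have cg: "continuous_on UNIV g" and cpsi: "continuous_on UNIV \<psi>"
    using has_vector_derivative_continuous[OF dg] has_vector_derivative_continuous[OF dpsi]
    by (simp_all add: continuous_on_eq_continuous_at)
  have det: "det (g t) = of_real (exp t)" for t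
    using a B by (simp add: g det_mul det_one_param trace_add unit_directions_iff exp_of_real)
  have hc: "horizontal_curve g u"
    unfolding horizontal_curve_def
  proof (intro conjI allI)
    show "g t \<in> GL_plus" for t
      using det[of t] by (auto simp: GL_plus_def intro!: exI[of _ "exp t"])
    show "\<exists>L. L-lipschitz_on {c..d} g" for c d
      by (rule lip[OF dg matrix_mult.continuous_on[OF cg cu]])
  qed (use u_hor dg in auto)
  have form0: "lie_form (u t) (gl_basis 0) = 1" "lie_form (\<psi> t) (gl_basis 0) = 1" for t
    using tru[of t] B(2) by (simp_all add: lie_form_gl_basis_0 u_gl psi) (simp add: \<psi>_def trace_sub)
  have "lie_form (u t) (u t) = 0" for t
  proof -
    have "u t \<bullet> u t = 1"
      using w[of t] by (simp add: u_def inner_add_left inner_add_right inner_gl_basis_0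
          inner_commute[of "w t" "gl_basis 0"] unit_directions_iff)
    then show ?thesis by (simp add: lie_form_eq u_gl tru)
  qed
  moreover have "u t \<noteq> 0" for t
    using tru[of t] by (auto simp: trace_def)
  ultimately have iso: "isotropic u" by (simp add: isotropic_def)
  have fut: "future_directed u" by (simp add: future_directed_def form0)
  have ac: "absolutely_continuous_on {c..d} \<psi>" for c d
  proof -
    have "continuous_on UNIV (\<lambda>t. lie_bracket (u t) (\<psi> t))"
      unfolding lie_bracket_def by (intro continuous_on_diff matrix_mult.continuous_on cu cpsi)
    from lip[OF dpsi this, of c d] show ?thesis
      using absolutely_continuous_on_lipschitz by blast
  qed
  have costate: "((\<lambda>s. lie_form (\<psi> s) v) has_real_derivative lie_form (\<psi> t) (lie_bracket (u t) v)) (at t)"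
    if v: "v \<in> gl_plus" for v t
  proof -
    have bl: "bounded_linear (\<lambda>X :: complex^2^2. 2 * Re (trace X) * Re (trace v) - 2 * (X \<bullet> v))"
      unfolding linear_conv_bounded_linear[symmetric]
      by (rule linearI) (simp_all add: trace_add trace_scaleR inner_add_left algebra_simps)
    have "((\<lambda>s. lie_form (\<psi> s) v) has_vector_derivative lie_form (lie_bracket (u t) (\<psi> t)) v) (at t)"
      unfolding lie_form_eq[OF psi v] lie_form_eq[OF lie_bracket_in_gl_plus v]
      by (rule bounded_linear.has_vector_derivative[OF bl dpsi])
    then show ?thesis
      by (simp add: has_real_derivative_iff_has_vector_derivative lie_form_bracket[OF u_hor psi v])
  qed
  have herm: "herm_part (\<psi> t) = gl_basis 0 + w t" for t
    using parts_unique(1)[of "u t" "- B"] adju[of t] B(1) by (simp add: \<psi>_def u_def adj_minus)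
  show "normal_isotropic_extremal g"
    unfolding normal_isotropic_extremal_def
    using hc iso fut w psi ac form0(2) costate arg_min_unit_directionsI[OF psi herm w]
    by (intro exI[of _ u] exI[of _ w] exI[of _ \<psi>]) (auto simp: u_def)
  show "g 0 = mat 1" by (simp add: g)
qed

section \<open>Coordinates of the initial data\<close>

lemma sum_0_6_split:
  fixes f :: "nat \<Rightarrow> 'a::ab_group_add"
  shows "(\<Sum>k=0..6. f k) = f 0 + (f 1 + f 2 + f 3) + (\<Sum>k=4..6. f k)"
proof -
  have "{4..6::nat} = {4, 5, 6}" by auto
  then show ?thesis by (simp add: atLeast0AtMost_6)
qed

text \<open>
  The basis elements of index at most 3 are Hermitian, the other ones skew-Hermitian.
\<close>

lemma adj_sum_gl_basis:
  "adj (\<Sum>k=0..6. c k *\<^sub>R gl_basis k) = (\<Sum>k=0..6. (if k \<le> 3 then c k else - c k) *\<^sub>R gl_basis k)"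
  unfolding sum_gl_basis by (simp add: vec_eq_iff forall_2 complex_eq_iff)

lemma sum_gl_basis_in_unit_directions:
  "(\<Sum>k=0..6. c k *\<^sub>R gl_basis k) \<in> unit_directions \<longleftrightarrow>
    c 0 = 0 \<and> c 4 = 0 \<and> c 5 = 0 \<and> c 6 = 0 \<and> (c 1)\<^sup>2 + (c 2)\<^sup>2 + (c 3)\<^sup>2 = 1"
  unfolding unit_directions_iff adj_sum_gl_basis sum_gl_basis_eq_iff trace_sum_gl_basis inner_sum_gl_basis
  by (auto simp: atLeast0AtMost_6 power2_eq_square)

lemma sum_gl_basis_skew:
  "adj (\<Sum>k=0..6. c k *\<^sub>R gl_basis k) = - (\<Sum>k=0..6. c k *\<^sub>R gl_basis k) \<longleftrightarrow> (\<forall>k\<le>3. c k = 0)"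
proof -
  have "- (\<Sum>k=0..6. c k *\<^sub>R gl_basis k) = (\<Sum>k=0..6. (- c k) *\<^sub>R gl_basis k)"
    by (simp add: sum_negf)
  moreover have "(\<forall>k\<in>{0..6}. (if k \<le> 3 then c k else - c k) = - c k) \<longleftrightarrow> (\<forall>k\<le>3. c k = 0)"
    by force
  ultimately show ?thesis
    by (simp only: adj_sum_gl_basis sum_gl_basis_eq_iff)
qed

lemma unit_directions_coords:
  "w \<in> unit_directions \<longleftrightarrow> (\<exists>c. w = c 1 *\<^sub>R gl_basis 1 + c 2 *\<^sub>R gl_basis 2 + c 3 *\<^sub>R gl_basis 3 \<and>
     (c 1)\<^sup>2 + (c 2)\<^sup>2 + (c (3::nat))\<^sup>2 = 1)"
proof
  assume w: "w \<in> unit_directions"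
  then have "w \<in> gl_plus" by (simp add: gl_plus_def unit_directions_iff)
  then obtain c where c: "w = (\<Sum>k=0..6. c k *\<^sub>R gl_basis k)" by (rule gl_plus_expand)
  have "c 0 = 0 \<and> c 4 = 0 \<and> c 5 = 0 \<and> c 6 = 0 \<and> (c 1)\<^sup>2 + (c 2)\<^sup>2 + (c 3)\<^sup>2 = 1"
    using w unfolding c sum_gl_basis_in_unit_directions .
  then show "\<exists>c. w = c 1 *\<^sub>R gl_basis 1 + c 2 *\<^sub>R gl_basis 2 + c 3 *\<^sub>R gl_basis 3 \<and>
     (c 1)\<^sup>2 + (c 2)\<^sup>2 + (c (3::nat))\<^sup>2 = 1"
    unfolding c by (intro exI[of _ c]) (simp add: atLeast0AtMost_6)
next
  assume "\<exists>c. w = c 1 *\<^sub>R gl_basis 1 + c 2 *\<^sub>R gl_basis 2 + c 3 *\<^sub>R gl_basis 3 \<and>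
     (c 1)\<^sup>2 + (c 2)\<^sup>2 + (c (3::nat))\<^sup>2 = 1"
  then obtain c :: "nat \<Rightarrow> real" where c: "w = c 1 *\<^sub>R gl_basis 1 + c 2 *\<^sub>R gl_basis 2 + c 3 *\<^sub>R gl_basis 3"
    "(c 1)\<^sup>2 + (c 2)\<^sup>2 + (c 3)\<^sup>2 = 1" by blast
  let ?c = "\<lambda>k. if k = 0 \<or> 3 < k then 0 else c k"
  have w: "w = (\<Sum>k=0..6. ?c k *\<^sub>R gl_basis k)"
    unfolding c(1) by (simp add: atLeast0AtMost_6)
  show "w \<in> unit_directions"
    unfolding w sum_gl_basis_in_unit_directions using c(2) by simp
qed

lemma skew_coords:
  "adj B = - B \<and> trace B = 0 \<longleftrightarrow> (\<exists>c. B = (\<Sum>k=4..6. c k *\<^sub>R gl_basis k))"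
proof
  assume B: "adj B = - B \<and> trace B = 0"
  then have "B \<in> gl_plus" by (simp add: gl_plus_def)
  then obtain c where c: "B = (\<Sum>k=0..6. c k *\<^sub>R gl_basis k)" by (rule gl_plus_expand)
  have "\<forall>k\<le>3. c k = 0"
    using conjunct1[OF B] unfolding c sum_gl_basis_skew .
  then show "\<exists>c. B = (\<Sum>k=4..6. c k *\<^sub>R gl_basis k)"
    unfolding c sum_0_6_split by auto
next
  assume "\<exists>c. B = (\<Sum>k=4..6. c k *\<^sub>R gl_basis k)"
  then obtain c where c: "B = (\<Sum>k=4..6. c k *\<^sub>R gl_basis k)" by blast
  have "B = (\<Sum>k=0..6. (if 3 < k then c k else 0) *\<^sub>R gl_basis k)"
    unfolding sum_0_6_split by (simp add: c)
  then show "adj B = - B \<and> trace B = 0"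
    using sum_gl_basis_skew[of "\<lambda>k. if 3 < k then c k else 0"]
      trace_sum_gl_basis[of "\<lambda>k. if 3 < k then c k else 0"] by simp
qed

theorem theorem7:
  fixes g :: "real \<Rightarrow> complex^2^2"
  shows "normal_isotropic_extremal g \<and> g 0 = mat 1 \<longleftrightarrow>
    (\<exists>\<alpha> :: nat \<Rightarrow> real.
       \<alpha> 0 = sqrt ((\<alpha> 1)\<^sup>2 + (\<alpha> 2)\<^sup>2 + (\<alpha> 3)\<^sup>2) \<and>
       sqrt ((\<alpha> 1)\<^sup>2 + (\<alpha> 2)\<^sup>2 + (\<alpha> 3)\<^sup>2) = 1 \<and>
       (\<forall>t. g t = mat_exp (t *\<^sub>R (\<Sum>i=0..6. \<alpha> i *\<^sub>R gl_basis i)) **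
                   mat_exp (- t *\<^sub>R (\<Sum>i=4..6. \<alpha> i *\<^sub>R gl_basis i))))"
  (is "?L \<longleftrightarrow> ?R")
proof
  assume ?L
  then obtain a B where a: "a \<in> unit_directions" and B: "adj B = - B" "trace B = 0"
    and g: "\<And>t. g t = one_param (gl_basis 0 + a + B) t ** one_param B (- t)"
    using normal_isotropic_extremal_imp_product by blast
  obtain c where c: "a = c 1 *\<^sub>R gl_basis 1 + c 2 *\<^sub>R gl_basis 2 + c 3 *\<^sub>R gl_basis 3"
      "(c 1)\<^sup>2 + (c 2)\<^sup>2 + (c (3::nat))\<^sup>2 = 1"
    using a unit_directions_coords by blast
  obtain d where d: "B = (\<Sum>k=4..6. d k *\<^sub>R gl_basis k)"
    using B skew_coords by blast
  define \<alpha> where "\<alpha> k = (if k = 0 then 1 else if k \<le> 3 then c k else d k)" for k :: nat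
  have B': "(\<Sum>i=4..6. \<alpha> i *\<^sub>R gl_basis i) = B"
    unfolding d by (rule sum.cong) (auto simp: \<alpha>_def)
  have "(\<Sum>i=0..6. \<alpha> i *\<^sub>R gl_basis i) = gl_basis 0 + a + B"
    unfolding sum_0_6_split B' c(1) by (simp add: \<alpha>_def)
  moreover have "\<alpha> 0 = 1" "(\<alpha> 1)\<^sup>2 + (\<alpha> 2)\<^sup>2 + (\<alpha> 3)\<^sup>2 = 1"
    using c(2) by (simp_all add: \<alpha>_def)
  ultimately show ?R
    using g by (intro exI[of _ \<alpha>]) (simp add: B' one_param_def)
next
  assume ?R
  then obtain \<alpha> :: "nat \<Rightarrow> real" where al: "\<alpha> 0 = 1" "(\<alpha> 1)\<^sup>2 + (\<alpha> 2)\<^sup>2 + (\<alpha> 3)\<^sup>2 = 1"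
    and g: "\<And>t. g t = mat_exp (t *\<^sub>R (\<Sum>i=0..6. \<alpha> i *\<^sub>R gl_basis i)) **
                   mat_exp (- t *\<^sub>R (\<Sum>i=4..6. \<alpha> i *\<^sub>R gl_basis i))"
    by auto
  define a where "a = \<alpha> 1 *\<^sub>R gl_basis 1 + \<alpha> 2 *\<^sub>R gl_basis 2 + \<alpha> 3 *\<^sub>R gl_basis 3"
  define B where "B = (\<Sum>k=4..6. \<alpha> k *\<^sub>R gl_basis k)"
  have a: "a \<in> unit_directions" using al(2) a_def unit_directions_coords by blast
  have B: "adj B = - B" "trace B = 0" using B_def skew_coords by blast+
  have "(\<Sum>i=0..6. \<alpha> i *\<^sub>R gl_basis i) = gl_basis 0 + a + B"
    unfolding sum_0_6_split a_def B_def by (simp add: al)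
  then have "g t = one_param (gl_basis 0 + a + B) t ** one_param B (- t)" for t
    unfolding one_param_def g B_def by simp
  from product_imp_normal_isotropic_extremal[OF a B this] show ?L by blast
qed

end
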